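(* Let $Q_1$ and $Q_2$ be $n\times n$ complex positive semidefinite matrices. Let $Q_2Q_1$ have polar decomposition $Q_2Q_1=U\,|Q_2Q_1|$, with unitary factor $U$. Then $\det(Q_1+U^*Q_2)$ is real and non-negative, and $$\det(Q_1+U^*Q_2)\le \det(Q_1+Q_2).$$
   Context: The dimension $n$ is arbitrary. For a square complex matrix $X$, $X^*$ denotes the conjugate transpose and $|X|=\sqrt{X^*X}$ (the positive semidefinite square root) denotes its modulus. A polar decomposition of $X$ is a factorisation $X=U|X|$ with $U$ unitary. Positive semidefinite matrices are in particular Hermitian.
   Formalization: For singular Q_1 the claim fails for some unitary U (n=1, Q_1=0, Q_2=1, U=i). Proved: real and non-negative for every U if Q_1 is invertible; the inequality for every U whose left-hand determinant is real; the whole conclusion for some U in all cases. *)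

theory Defs
  imports "Jordan_Normal_Form.Schur_Decomposition"
begin

definition hermitian_mat :: "complex mat \<Rightarrow> bool" where
  "hermitian_mat A \<longleftrightarrow> mat_adjoint A = A"

(* (A *v v) \<bullet>c v is v^* A v.  In the order on complex numbers, 0 \<le> z says that
   z is real and non-negative.  A Hermitian matrix is automatically square. *)
definition psd_mat :: "complex mat \<Rightarrow> bool" where
  "psd_mat A \<longleftrightarrow>
     hermitian_mat A \<and> (\<forall>v \<in> carrier_vec (dim_row A). 0 \<le> (A *\<^sub>v v) \<bullet>c v)"

definition unitary_mat :: "complex mat \<Rightarrow> bool" where
  "unitary_mat U \<longleftrightarrow>
     square_mat U \<and> mat_adjoint U * U = 1\<^sub>m (dim_row U) \<and> U * mat_adjoint U = 1\<^sub>m (dim_row U)"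

definition psd_sqrt :: "complex mat \<Rightarrow> complex mat" where
  "psd_sqrt A = (THE B. psd_mat B \<and> B * B = A)"

definition mat_modulus :: "complex mat \<Rightarrow> complex mat" where
  "mat_modulus X = psd_sqrt (mat_adjoint X * X)"

(* The unitary factor U is unique exactly when X is invertible, so this is a relation
   between X and U. *)
definition polar_decomposition :: "complex mat \<Rightarrow> complex mat \<Rightarrow> bool" where
  "polar_decomposition X U \<longleftrightarrow> unitary_mat U \<and> X = U * mat_modulus X"

lemma adjoint_mat_1: "mat_adjoint (mat 1 1 (\<lambda>_. z)) = mat 1 1 (\<lambda>_. cnj z)"
  by (rule eq_matI) (auto simp: mat_adjoint_def mat_of_rows_def cols_def conjugate_vec_def)

lemma mult_mat_1: "mat 1 1 (\<lambda>_. a) * mat 1 1 (\<lambda>_. b) = mat 1 1 (\<lambda>_. a * (b::complex))"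
  by (rule eq_matI) (auto simp: scalar_prod_def)

lemma one_mat_1: "(1\<^sub>m 1 :: complex mat) = mat 1 1 (\<lambda>_. 1)" by (rule eq_matI) auto

lemma psd_mat_1: "z \<ge> 0 \<Longrightarrow> psd_mat (mat 1 1 (\<lambda>_. z))"
  unfolding psd_mat_def hermitian_mat_def adjoint_mat_1
  apply (auto simp: less_eq_complex_def complex_eq_iff scalar_prod_def intro!: eq_matI)
  subgoal for v
  proof -
    assume "0 \<le> Re z"
    then have "0 \<le> Re z * (Re (v$0) * Re (v$0)) + Re z * (Im (v$0) * Im (v$0))" by simp
    then show ?thesis
      by (simp add: algebra_simps)
  qed
  done

lemma psd_sqrt_0_mat_1: "psd_sqrt (mat 1 1 (\<lambda>_. 0)) = mat 1 1 (\<lambda>_. 0)"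
  unfolding psd_sqrt_def
proof (rule the_equality)
  show "psd_mat (mat 1 1 (\<lambda>_. 0)) \<and> mat 1 1 (\<lambda>_. 0::complex) * mat 1 1 (\<lambda>_. 0) = mat 1 1 (\<lambda>_. 0)"
    using psd_mat_1[of 0] mult_mat_1[of 0 0] by simp
next
  fix B :: "complex mat" assume a: "psd_mat B \<and> B * B = mat 1 1 (\<lambda>_. 0)"
  then have d: "dim_row B = 1" "dim_col B = 1"
    by (metis dim_row_mat(1) index_mult_mat(2), metis dim_col_mat(1) index_mult_mat(3))
  have e: "B = mat 1 1 (\<lambda>_. B $$ (0,0))" by (rule eq_matI) (auto simp: d)
  have "(B * B) $$ (0,0) = B $$ (0,0) * B $$ (0,0)"
    by (subst (1 2) e, subst mult_mat_1) simp
  then have "B $$ (0,0) = 0" using a by simp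
  then show "B = mat 1 1 (\<lambda>_. 0)" using e by simp
qed

(* For singular Q1 the determinant of Q1 + U^* Q2 need not be real for every unitary factor U
   of Q2 Q1, because U is arbitrary on the kernel of Q2 Q1. *)
lemma polar_factor_det_not_real:
  defines "Q1 \<equiv> mat 1 1 (\<lambda>_. 0)" and "Q2 \<equiv> mat 1 1 (\<lambda>_. 1)" and "U \<equiv> mat 1 1 (\<lambda>_. \<i>)"
  shows "psd_mat Q1" "psd_mat Q2" "polar_decomposition (Q2 * Q1) U"
    "det (Q1 + mat_adjoint U * Q2) = - \<i>"
proof -
  show "psd_mat Q1" "psd_mat Q2"
    unfolding Q1_def Q2_def using psd_mat_1[of 0] psd_mat_1[of 1] by (simp_all add: less_eq_complex_def)
  show "polar_decomposition (Q2 * Q1) U"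
    unfolding polar_decomposition_def mat_modulus_def Q1_def Q2_def U_def unitary_mat_def
      dim_row_mat adjoint_mat_1 mult_mat_1 one_mat_1 mult_zero_right psd_sqrt_0_mat_1
    by simp
  show "det (Q1 + mat_adjoint U * Q2) = - \<i>"
    unfolding Q1_def Q2_def U_def adjoint_mat_1 mult_mat_1 by (subst det_single) auto
qed

end

theory Submission
  imports Defs
begin

text \<open>Write V for the adjoint of U, so that V Q2 Q1 is the modulus of Q2 Q1, and put
  K = Q1 + V Q2. The matrix K Q1 is positive semidefinite; hence, if K is invertible, then
  C = K^-1 Q1 and R = K^-1 V Q2 = 1 - C are positive semidefinite as well.

  For positive semidefinite P, R and arbitrary W, the Cauchy-Schwarz inequality for forms gives
  |det (P + R W)|^2 \<le> det (P + R) det (P + W^* R W).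
  For Q1, Q2 and V^* it bounds |det K|^2 by det (Q1 + Q2) det (Q1 + V Q2 V^*), and the last matrix
  equals K (C + R V^*). For C, R and V^* it bounds |det (C + R V^*)|^2 by det (C + V R V^*), which is
  at most 1 by the arithmetic-geometric mean inequality, the trace being n. Together
  |det K| \<le> det (Q1 + Q2).

  If Q1 is invertible, det K = det Q1 / det C is nonnegative. If Q1 is singular, V may be
  multiplied by a unitary matrix that fixes the range of Q1 and has any prescribed determinant of
  modulus one, which makes det K nonnegative.\<close>

section \<open>Adjoints, unitary matrices and traces\<close>

lemma mult_carrier_square [simp]:
  "A \<in> carrier_mat n n \<Longrightarrow> B \<in> carrier_mat n n \<Longrightarrow> A * B \<in> carrier_mat n n"
  by (rule mult_carrier_mat)

lemma dim_adjoint [simp]: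
  "dim_row (mat_adjoint A) = dim_col A" "dim_col (mat_adjoint A) = dim_row A"
  by (auto simp: mat_adjoint_def)

lemma adjoint_carrier [simp, intro]: "A \<in> carrier_mat n m \<Longrightarrow> mat_adjoint A \<in> carrier_mat m n"
  by (auto intro!: carrier_matI)

lemma adjoint_index [simp]:
  "i < dim_col A \<Longrightarrow> j < dim_row A \<Longrightarrow> mat_adjoint A $$ (i, j) = conjugate (A $$ (j, i))"
  unfolding mat_adjoint_def by (subst mat_of_rows_index) auto

lemma adjoint_adjoint [simp]: "mat_adjoint (mat_adjoint A) = A"
  by (rule eq_matI) auto

lemma adjoint_mult:
  fixes A B :: "complex mat"
  assumes "A \<in> carrier_mat n m" "B \<in> carrier_mat m k"
  shows "mat_adjoint (A * B) = mat_adjoint B * mat_adjoint A"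
  using assms by (intro eq_matI) (auto simp: scalar_prod_def mult.commute)

lemma adjoint_add:
  fixes A B :: "complex mat"
  assumes "A \<in> carrier_mat n m" "B \<in> carrier_mat n m"
  shows "mat_adjoint (A + B) = mat_adjoint A + mat_adjoint B"
  using assms by (intro eq_matI) auto

lemma adjoint_minus:
  fixes A B :: "complex mat"
  assumes "A \<in> carrier_mat n m" "B \<in> carrier_mat n m"
  shows "mat_adjoint (A - B) = mat_adjoint A - mat_adjoint B"
  using assms by (intro eq_matI) auto

lemma adjoint_one [simp]: "mat_adjoint (1\<^sub>m n :: complex mat) = 1\<^sub>m n"
  by (intro eq_matI) auto

lemma adjoint_mat_diag: "mat_adjoint (mat_diag n d :: complex mat) = mat_diag n (\<lambda>i. cnj (d i))"
  by (intro eq_matI) (auto simp: mat_diag_def)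

lemma det_adjoint:
  fixes A :: "complex mat"
  assumes A: "A \<in> carrier_mat n n"
  shows "det (mat_adjoint A) = cnj (det A)"
proof -
  interpret comm_ring_hom cnj by unfold_locales auto
  have "mat_adjoint A = map_mat cnj (transpose_mat A)"
    using A by (intro eq_matI) auto
  then show ?thesis
    using det_transpose[OF A] by simp
qed

lemma cscalar_prod_adjoint:
  fixes A :: "complex mat"
  assumes A: "A \<in> carrier_mat n m" and x: "x \<in> carrier_vec m" and y: "y \<in> carrier_vec n"
  shows "(A *\<^sub>v x) \<bullet>c y = x \<bullet>c (mat_adjoint A *\<^sub>v y)"
proof -
  have "(A *\<^sub>v x) \<bullet>c y = (\<Sum>i<n. \<Sum>j<m. A $$ (i, j) * x $ j * cnj (y $ i))"
    using assms by (auto simp: scalar_prod_def sum_distrib_right atLeast0LessThan intro!: sum.cong)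
  also have "\<dots> = (\<Sum>j<m. \<Sum>i<n. A $$ (i, j) * x $ j * cnj (y $ i))"
    by (rule sum.swap)
  also have "\<dots> = x \<bullet>c (mat_adjoint A *\<^sub>v y)"
    using assms by (auto simp: scalar_prod_def sum_distrib_left atLeast0LessThan mult_ac intro!: sum.cong)
  finally show ?thesis .
qed

section \<open>Traces and diagonal matrices\<close>

definition mat_trace :: "complex mat \<Rightarrow> complex" where
  "mat_trace A = (\<Sum>i<dim_row A. A $$ (i, i))"

lemma mat_trace_comm:
  assumes "A \<in> carrier_mat n m" "B \<in> carrier_mat m n"
  shows "mat_trace (A * B) = mat_trace (B * A)"
proof -
  have "mat_trace (A * B) = (\<Sum>i<n. \<Sum>j<m. A $$ (i, j) * B $$ (j, i))"
    using assms by (auto simp: mat_trace_def scalar_prod_def atLeast0LessThan intro!: sum.cong)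
  also have "\<dots> = (\<Sum>j<m. \<Sum>i<n. A $$ (i, j) * B $$ (j, i))"
    by (rule sum.swap)
  also have "\<dots> = mat_trace (B * A)"
    using assms by (auto simp: mat_trace_def scalar_prod_def atLeast0LessThan mult_ac intro!: sum.cong)
  finally show ?thesis .
qed

lemma mat_trace_add:
  assumes "A \<in> carrier_mat n n" "B \<in> carrier_mat n n"
  shows "mat_trace (A + B) = mat_trace A + mat_trace B"
  using assms by (simp add: mat_trace_def sum.distrib)

lemma mat_trace_one [simp]: "mat_trace (1\<^sub>m n) = of_nat n"
  by (simp add: mat_trace_def)

lemma mat_trace_diag: "mat_trace (mat_diag n d) = (\<Sum>i<n. d i)"
  by (simp add: mat_trace_def mat_diag_def)

lemma det_mat_diag: "det (mat_diag n d :: complex mat) = (\<Prod>i<n. d i)"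
proof -
  have "det (mat_diag n d) = prod_list (diag_mat (mat_diag n d))"
    by (rule det_upper_triangular[where n = n]) (auto simp: mat_diag_def upper_triangular_def)
  also have "\<dots> = (\<Prod>i<n. d i)"
    by (simp add: diag_mat_def prod.list_conv_set_nth mat_diag_def atLeast0LessThan)
  finally show ?thesis .
qed

section \<open>Unitary matrices and Hermitian conjugation\<close>

lemma unitary_matD:
  assumes "unitary_mat U" "U \<in> carrier_mat n n"
  shows "mat_adjoint U * U = 1\<^sub>m n" "U * mat_adjoint U = 1\<^sub>m n"
  using assms by (auto simp: unitary_mat_def)

lemma unitary_matI:
  assumes "U \<in> carrier_mat n n" "mat_adjoint U * U = 1\<^sub>m n"
  shows "unitary_mat U"
  using assms mat_mult_left_right_inverse[of "mat_adjoint U" n U] by (auto simp: unitary_mat_def)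

lemma unitary_mat_one: "unitary_mat (1\<^sub>m n)"
  by (rule unitary_matI[of _ n]) auto

lemma unitary_mat_adjoint:
  assumes "unitary_mat U" "U \<in> carrier_mat n n"
  shows "unitary_mat (mat_adjoint U)"
  using assms unitary_matD[OF assms] by (intro unitary_matI[of _ n]) auto

text \<open>Associativity brings products into right-nested form; this rule then cancels an inverse
  pair that stands in front of a remaining factor.\<close>

lemma mult_cancel_middle:
  fixes U V :: "complex mat"
  assumes "U * V = 1\<^sub>m n" "U \<in> carrier_mat n n" "V \<in> carrier_mat n n" "A \<in> carrier_mat n n"
  shows "U * (V * A) = A"
  using assms by (subst assoc_mult_mat[of _ n n _ n _ n, symmetric]) auto

lemma unitary_mat_mult:
  assumes "unitary_mat U" "U \<in> carrier_mat n n" "unitary_mat V" "V \<in> carrier_mat n n"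
  shows "unitary_mat (U * V)"
proof (rule unitary_matI)
  show "U * V \<in> carrier_mat n n" using assms by simp
  have "mat_adjoint (U * V) * (U * V) = mat_adjoint V * (mat_adjoint U * (U * V))"
    using assms by (simp add: adjoint_mult[of _ n n _ n] assoc_mult_mat[of _ n n _ n _ n])
  also have "\<dots> = 1\<^sub>m n"
    using assms by (simp add: mult_cancel_middle[of _ _ n] unitary_matD[of _ n])
  finally show "mat_adjoint (U * V) * (U * V) = 1\<^sub>m n" .
qed

lemma hermitian_matD:
  assumes "hermitian_mat A"
  shows "mat_adjoint A = A" "dim_row A = dim_col A"
  using assms dim_adjoint[of A] by (auto simp: hermitian_mat_def)

lemma hermitian_conjugation:
  assumes "hermitian_mat A" "A \<in> carrier_mat n n" "B \<in> carrier_mat n n"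
  shows "hermitian_mat (mat_adjoint B * A * B)"
  using assms
  by (simp add: hermitian_mat_def adjoint_mult[of _ n n _ n] assoc_mult_mat[of _ n n _ n _ n])

section \<open>The spectral theorem\<close>

text \<open>The reflection in the hyperplane orthogonal to \<open>w = v - unit_vec n k\<close>
  exchanges two vectors of equal length whose inner product is real, hence the condition on
  \<open>v $ k\<close>. It fixes every vector orthogonal to \<open>w\<close>, in particular the unit
  vectors at the other coordinates where \<open>v\<close> vanishes.\<close>

lemma householder_reflection:
  fixes v :: "complex vec"
  assumes v: "v \<in> carrier_vec n" "v \<bullet>c v = 1" and k: "k < n" and real: "v $ k \<in> \<real>"
  shows "\<exists>W \<in> carrier_mat n n. unitary_mat W \<and> W *\<^sub>v unit_vec n k = v \<and>
           (\<forall>i<n. i \<noteq> k \<longrightarrow> v $ i = 0 \<longrightarrow> W *\<^sub>v unit_vec n i = unit_vec n i)"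
proof (cases "v = unit_vec n k")
  case True
  then show ?thesis
    using unitary_mat_one[of n] by (intro bexI[of _ "1\<^sub>m n"]) auto
next
  case False
  define w where "w = v - unit_vec n k"
  have w: "w \<in> carrier_vec n" using v by (simp add: w_def)
  define s where "s = w \<bullet>c w"
  have "w \<noteq> 0\<^sub>v n"
  proof
    assume "w = 0\<^sub>v n"
    then have "v $ i = unit_vec n k $ i" if "i < n" for i
      using that v unfolding w_def by (metis carrier_vecD eq_iff_diff_eq_0 index_minus_vec(1) index_unit_vec(3) index_zero_vec(1))
    then show False using False v by (metis carrier_vecD eq_vecI index_unit_vec(3))
  qed
  then have s0: "s \<noteq> 0" using w by (simp add: s_def)
  have s_sum: "s = (\<Sum>i<n. w $ i * cnj (w $ i))"
    using w by (auto simp: s_def scalar_prod_def atLeast0LessThan intro!: sum.cong)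
  have cnj_s: "cnj s = s" by (simp add: s_sum mult.commute)
  have vk: "cnj (v $ k) = v $ k" using real by (simp add: Reals_cnj_iff)
  \<comment> \<open>Coordinate \<open>k\<close> is split off: elsewhere \<open>v\<close> and
    \<open>w\<close> agree, and the unit length of \<open>v\<close> gives the rest of the
    sum.\<close>
  have "s = 2 - 2 * v $ k"
  proof -
    have "1 = (\<Sum>i<n. v $ i * cnj (v $ i))"
      using v by (auto simp: scalar_prod_def atLeast0LessThan intro!: sum.cong)
    also have "\<dots> = v $ k * v $ k + (\<Sum>i\<in>{..<n}-{k}. v $ i * cnj (v $ i))"
      using k by (subst sum.remove[of _ k]) (auto simp: vk)
    finally have 1: "(\<Sum>i\<in>{..<n}-{k}. v $ i * cnj (v $ i)) = 1 - v $ k * v $ k"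
      by (simp add: algebra_simps)
    have "s = (v $ k - 1) * (v $ k - 1) + (\<Sum>i\<in>{..<n}-{k}. w $ i * cnj (w $ i))"
      unfolding s_sum using k v by (subst sum.remove[of _ k]) (auto simp: vk w_def)
    also have "(\<Sum>i\<in>{..<n}-{k}. w $ i * cnj (w $ i)) = (\<Sum>i\<in>{..<n}-{k}. v $ i * cnj (v $ i))"
      using k v by (intro sum.cong) (auto simp: w_def)
    finally show ?thesis by (simp add: 1 algebra_simps)
  qed
  \<comment> \<open>Column \<open>k\<close> of the reflection defined next is
    \<open>unit_vec n k\<close> plus this coefficient times \<open>w\<close>; the value 1 makes it
    \<open>v\<close>.\<close>
  then have wk: "- 2 * cnj (w $ k) / s = 1"
    using k v s0 by (simp add: w_def vk field_simps)
  define W where "W = mat n n (\<lambda>(i, j). (if i = j then 1 else 0) - 2 * w $ i * cnj (w $ j) / s)"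
  have W: "W \<in> carrier_mat n n" by (simp add: W_def)
  have adj: "mat_adjoint W = W"
    by (intro eq_matI) (auto simp: W_def cnj_s mult_ac)
  have "W * W = 1\<^sub>m n"
  proof (rule eq_matI)
    fix i j assume ij: "i < dim_row (1\<^sub>m n :: complex mat)" "j < dim_col (1\<^sub>m n :: complex mat)"
    let ?d = "\<lambda>a b. if a = b then 1 else 0 :: complex"
    have dl: "(\<Sum>l<n. ?d i l * f l) = f i" for f
    proof -
      have "(\<Sum>l<n. ?d i l * f l) = (\<Sum>l<n. if i = l then f l else 0)" by (intro sum.cong) auto
      then show ?thesis using ij by simp
    qed
    have dr: "(\<Sum>l<n. f l * ?d l j) = f j" for f
    proof -
      have "(\<Sum>l<n. f l * ?d l j) = (\<Sum>l<n. if l = j then f l else 0)" by (intro sum.cong) auto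
      then show ?thesis using ij by simp
    qed
    have "(W * W) $$ (i, j) = (\<Sum>l<n. (?d i l - 2 * w $ i * cnj (w $ l) / s) * (?d l j - 2 * w $ l * cnj (w $ j) / s))"
      using ij by (auto simp: W_def scalar_prod_def atLeast0LessThan)
    also have "\<dots> = (\<Sum>l<n. ?d i l * ?d l j - ?d i l * (2 * w $ l * cnj (w $ j) / s)
        - (2 * w $ i * cnj (w $ l) / s) * ?d l j
        + (4 * w $ i * cnj (w $ j) / (s * s)) * (w $ l * cnj (w $ l)))"
    proof (rule sum.cong[OF refl])
      fix l
      have "(2 * w $ i * cnj (w $ l) / s) * (2 * w $ l * cnj (w $ j) / s) =
          (4 * w $ i * cnj (w $ j) / (s * s)) * (w $ l * cnj (w $ l))" by simp
      then show "(?d i l - 2 * w $ i * cnj (w $ l) / s) * (?d l j - 2 * w $ l * cnj (w $ j) / s) =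
          ?d i l * ?d l j - ?d i l * (2 * w $ l * cnj (w $ j) / s) - (2 * w $ i * cnj (w $ l) / s) * ?d l j
          + (4 * w $ i * cnj (w $ j) / (s * s)) * (w $ l * cnj (w $ l))"
        by (simp only: left_diff_distrib right_diff_distrib) simp
    qed
    also have "\<dots> = (\<Sum>l<n. ?d i l * ?d l j) - (\<Sum>l<n. ?d i l * (2 * w $ l * cnj (w $ j) / s))
        - (\<Sum>l<n. (2 * w $ i * cnj (w $ l) / s) * ?d l j)
        + (4 * w $ i * cnj (w $ j) / (s * s)) * (\<Sum>l<n. w $ l * cnj (w $ l))"
      by (simp only: sum.distrib sum_subtractf sum_distrib_left)
    \<comment> \<open>The last sum is \<open>s\<close>, so the quadratic term cancels the two mixed
      terms.\<close>
    also have "\<dots> = ?d i j"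
      using ij s0 unfolding dl dr by (simp add: s_sum[symmetric])
    finally show "(W * W) $$ (i, j) = 1\<^sub>m n $$ (i, j)" using ij by auto
  qed (auto simp: W_def)
  then have "unitary_mat W" using W adj by (intro unitary_matI[of _ n]) auto
  moreover have "W *\<^sub>v unit_vec n k = v"
  proof (rule eq_vecI)
    fix i assume i: "i < dim_vec v"
    have "(W *\<^sub>v unit_vec n k) $ i = W $$ (i, k)"
      using W i k v by (simp add: scalar_prod_right_unit)
    also have "\<dots> = (if i = k then 1 else 0) + w $ i * (- 2 * cnj (w $ k) / s)"
      using i k v by (simp add: W_def)
    also have "\<dots> = v $ i" using i k v unfolding wk by (simp add: w_def)
    finally show "(W *\<^sub>v unit_vec n k) $ i = v $ i" .
  qed (use W v in auto)
  moreover have "W *\<^sub>v unit_vec n i = unit_vec n i" if "i < n" "i \<noteq> k" "v $ i = 0" for i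
  proof (rule eq_vecI)
    fix l assume l: "l < dim_vec (unit_vec n i :: complex vec)"
    have "(W *\<^sub>v unit_vec n i) $ l = W $$ (l, i)"
      using W l that by (simp add: scalar_prod_right_unit)
    also have "\<dots> = unit_vec n i $ l" using l that v k by (simp add: W_def w_def)
    finally show "(W *\<^sub>v unit_vec n i) $ l = unit_vec n i $ l" .
  qed (use W that in auto)
  ultimately show ?thesis using W by blast
qed

text \<open>Besides unit length, the scalar supplies a phase, because the reflection requires a real
  coordinate.\<close>

lemma normalize_vec:
  fixes v :: "complex vec"
  assumes v: "v \<in> carrier_vec n" "v \<noteq> 0\<^sub>v n" and k: "k < n"
  shows "\<exists>c. (c \<cdot>\<^sub>v v) \<bullet>c (c \<cdot>\<^sub>v v) = 1 \<and> (c \<cdot>\<^sub>v v) $ k \<in> \<real>"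
proof -
  define r where "r = Re (v \<bullet>c v)"
  have "v \<bullet>c v > 0" using v by simp
  then have r: "r > 0" "v \<bullet>c v = of_real r" by (auto simp: r_def less_complex_def complex_eq_iff)
  \<comment> \<open>This phase turns \<open>v $ k\<close> into its modulus. If the coordinate is
    zero, any phase serves, and 1 is taken.\<close>
  define a where "a = (if v $ k = 0 then 1 else cnj (v $ k) / of_real (cmod (v $ k)))"
  have "cmod a = 1" by (simp add: a_def norm_divide)
  then have a1: "a * cnj a = 1" by (metis complex_norm_square of_real_1 one_power2)
  have a2: "a * v $ k = of_real (cmod (v $ k))"
    by (auto simp: a_def complex_norm_square[symmetric] power2_eq_square field_simps)
  define c where "c = a / of_real (sqrt r)"
  have "(c \<cdot>\<^sub>v v) \<bullet>c (c \<cdot>\<^sub>v v) = c * cnj c * (v \<bullet>c v)"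
    using v by (simp add: conjugate_smult_vec)
  also have "c * cnj c = 1 / of_real r"
    using r a1 by (simp add: c_def of_real_mult[symmetric] del: of_real_mult)
  finally have "(c \<cdot>\<^sub>v v) \<bullet>c (c \<cdot>\<^sub>v v) = 1" using r by simp
  moreover have "(c \<cdot>\<^sub>v v) $ k = of_real (cmod (v $ k) / sqrt r)"
    using a2 v k by (simp add: c_def)
  ultimately show ?thesis by (metis Reals_of_real)
qed

text \<open>The characteristic polynomial has degree \<open>n > 0\<close> and therefore a complex
  root.\<close>

lemma exists_eigenvector:
  fixes A :: "complex mat"
  assumes A: "A \<in> carrier_mat n n" and "n > 0"
  shows "\<exists>v \<mu>. v \<in> carrier_vec n \<and> v \<noteq> 0\<^sub>v n \<and> A *\<^sub>v v = \<mu> \<cdot>\<^sub>v v"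
proof -
  have "degree (char_poly A) = n" using degree_monic_char_poly[OF A] by simp
  then have "\<not> constant (poly (char_poly A))" using \<open>n > 0\<close> by (simp add: constant_degree)
  then obtain \<mu> where "poly (char_poly A) \<mu> = 0" using fundamental_theorem_of_algebra by blast
  then have "eigenvalue A \<mu>" using eigenvalue_root_char_poly[OF A] by simp
  then show ?thesis using A by (auto simp: eigenvalue_def eigenvector_def)
qed

lemma mult_mat_unit_vec:
  fixes A :: "complex mat"
  assumes "A \<in> carrier_mat n n" "j < n"
  shows "A *\<^sub>v unit_vec n j = col A j"
  using assms by (intro eq_vecI) (auto simp: scalar_prod_right_unit)

text \<open>Induction on the number of unit vectors that are already eigenvectors: the block on the
  remaining coordinates has an eigenvector, and a Householder reflection carries the next unit
  vector to it while fixing the unit vectors treated before.\<close>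

lemma spectral_partial:
  fixes A :: "complex mat"
  assumes A: "A \<in> carrier_mat n n" "hermitian_mat A" and "k \<le> n"
  shows "\<exists>U \<in> carrier_mat n n. unitary_mat U \<and>
           (\<forall>j<k. \<exists>c. (mat_adjoint U * A * U) *\<^sub>v unit_vec n j = c \<cdot>\<^sub>v unit_vec n j)"
  using \<open>k \<le> n\<close>
proof (induction k)
  case 0
  then show ?case using unitary_mat_one by (intro bexI[of _ "1\<^sub>m n"]) auto
next
  case (Suc k)
  then obtain U where U: "U \<in> carrier_mat n n" "unitary_mat U"
    "\<forall>j<k. \<exists>c. (mat_adjoint U * A * U) *\<^sub>v unit_vec n j = c \<cdot>\<^sub>v unit_vec n j" by auto
  have k: "k < n" using Suc by simp
  define B where "B = mat_adjoint U * A * U"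
  have B: "B \<in> carrier_mat n n" using A U by (simp add: B_def)
  have hB: "hermitian_mat B" unfolding B_def using A U by (intro hermitian_conjugation)
  \<comment> \<open>The first \<open>k\<close> columns vanish off the diagonal; \<open>B0'\<close>
    carries this over to the rows by Hermitian symmetry. Hence \<open>B\<close> preserves the span
    of the coordinates from \<open>k\<close> on.\<close>
  have B0: "B $$ (i, j) = 0" if "i < n" "j < k" "i \<noteq> j" for i j
  proof -
    obtain c where "B *\<^sub>v unit_vec n j = c \<cdot>\<^sub>v unit_vec n j" using U \<open>j < k\<close> by (auto simp: B_def)
    then have "(B *\<^sub>v unit_vec n j) $ i = (c \<cdot>\<^sub>v unit_vec n j) $ i" by simp
    then show ?thesis using that B k by (simp add: scalar_prod_right_unit)
  qed
  have B0': "B $$ (i, j) = 0" if "i < k" "j < n" "i \<noteq> j" for i j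
  proof -
    have "B $$ (i, j) = cnj (B $$ (j, i))"
      using hermitian_matD(1)[OF hB] adjoint_index[of i B j] that B k by simp
    then show ?thesis using B0[of j i] that k by simp
  qed
  \<comment> \<open>The block of \<open>B\<close> on the coordinates from \<open>k\<close> on. Its
    eigenvector, padded with \<open>k\<close> leading zeros, is an eigenvector of
    \<open>B\<close>.\<close>
  define C where "C = mat (n - k) (n - k) (\<lambda>(i, j). B $$ (i + k, j + k))"
  have "C \<in> carrier_mat (n - k) (n - k)" by (simp add: C_def)
  then obtain x \<mu> where x: "x \<in> carrier_vec (n - k)" "x \<noteq> 0\<^sub>v (n - k)" "C *\<^sub>v x = \<mu> \<cdot>\<^sub>v x"
    using exists_eigenvector[of C "n - k"] k by auto
  define y where "y = vec n (\<lambda>i. if i < k then 0 else x $ (i - k))"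
  have y: "y \<in> carrier_vec n" by (simp add: y_def)
  have y0: "y \<noteq> 0\<^sub>v n"
  proof
    assume "y = 0\<^sub>v n"
    then have "y $ (i + k) = 0" if "i < n - k" for i using that by simp
    then have "x $ i = 0" if "i < n - k" for i using that by (auto simp: y_def)
    then have "x = 0\<^sub>v (n - k)" using x by (intro eq_vecI) auto
    then show False using x by simp
  qed
  have Bsum: "(B *\<^sub>v y) $ i = (\<Sum>j<n - k. B $$ (i, j + k) * x $ j)" if "i < n" for i
  proof -
    have "(B *\<^sub>v y) $ i = (\<Sum>j<n. B $$ (i, j) * y $ j)"
      using that B y by (auto simp: scalar_prod_def atLeast0LessThan)
    also have "\<dots> = (\<Sum>j\<in>{k..<n}. B $$ (i, j) * y $ j)"
      by (rule sum.mono_neutral_right) (auto simp: y_def)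
    also have "\<dots> = (\<Sum>j<n - k. B $$ (i, j + k) * x $ j)"
      using k by (intro sum.reindex_bij_witness[of _ "\<lambda>j. j + k" "\<lambda>j. j - k"]) (auto simp: y_def)
    finally show ?thesis .
  qed
  have By: "B *\<^sub>v y = \<mu> \<cdot>\<^sub>v y"
  proof (rule eq_vecI)
    fix i assume "i < dim_vec (\<mu> \<cdot>\<^sub>v y)"
    then have i: "i < n" using y by simp
    show "(B *\<^sub>v y) $ i = (\<mu> \<cdot>\<^sub>v y) $ i"
    proof (cases "i < k")
      case True
      then show ?thesis using i by (simp add: Bsum B0') (simp add: y_def)
    next
      case False
      have "(C *\<^sub>v x) $ (i - k) = (\<Sum>j<n - k. B $$ (i, j + k) * x $ j)"
        using i False x(1) by (simp add: C_def scalar_prod_def atLeast0LessThan)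
      then have "(B *\<^sub>v y) $ i = (C *\<^sub>v x) $ (i - k)" using i by (simp add: Bsum)
      then show ?thesis using i False x by (simp add: y_def)
    qed
  qed (use B y in auto)
  obtain c where c: "(c \<cdot>\<^sub>v y) \<bullet>c (c \<cdot>\<^sub>v y) = 1" "(c \<cdot>\<^sub>v y) $ k \<in> \<real>"
    using normalize_vec[OF y y0 k] by auto
  define v where "v = c \<cdot>\<^sub>v y"
  have v: "v \<in> carrier_vec n" using y by (simp add: v_def)
  have Bv: "B *\<^sub>v v = \<mu> \<cdot>\<^sub>v v"
    unfolding v_def using B y By by (simp add: mult_mat_vec smult_smult_assoc mult.commute)
  \<comment> \<open>These zeros ensure that the reflection \<open>W\<close> fixes the unit vectors
    treated before.\<close>
  have v0: "v $ i = 0" if "i < k" for i using that k by (simp add: v_def y_def)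
  obtain W where W: "W \<in> carrier_mat n n" "unitary_mat W" "W *\<^sub>v unit_vec n k = v"
    "\<And>i. i < n \<Longrightarrow> i \<noteq> k \<Longrightarrow> v $ i = 0 \<Longrightarrow> W *\<^sub>v unit_vec n i = unit_vec n i"
    using householder_reflection[OF v _ k] c by (auto simp: v_def)
  \<comment> \<open>Since \<open>W\<close> is unitary, an eigenvector of \<open>B\<close> that is
    the image of a unit vector under \<open>W\<close> pulls back to that unit vector.\<close>
  have key: "(mat_adjoint W * B * W) *\<^sub>v unit_vec n j = a \<cdot>\<^sub>v unit_vec n j"
    if "B *\<^sub>v (W *\<^sub>v unit_vec n j) = a \<cdot>\<^sub>v (W *\<^sub>v unit_vec n j)" for a j
  proof -
    have "(mat_adjoint W * B * W) *\<^sub>v unit_vec n j = mat_adjoint W *\<^sub>v (B *\<^sub>v (W *\<^sub>v unit_vec n j))"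
      using W B by (simp add: assoc_mult_mat_vec[of _ n n _ n])
    also have "\<dots> = a \<cdot>\<^sub>v ((mat_adjoint W * W) *\<^sub>v unit_vec n j)"
      unfolding that using W by (simp add: mult_mat_vec[of _ n n] assoc_mult_mat_vec[of _ n n _ n])
    finally show ?thesis using unitary_matD[OF W(2,1)] by simp
  qed
  have UW: "mat_adjoint (U * W) * A * (U * W) = mat_adjoint W * B * W"
    using U W A unfolding B_def
    by (simp add: adjoint_mult[of _ n n _ n] assoc_mult_mat[of _ n n _ n _ n])
  have "\<exists>a. (mat_adjoint (U * W) * A * (U * W)) *\<^sub>v unit_vec n j = a \<cdot>\<^sub>v unit_vec n j" if "j < Suc k" for j
  proof (cases "j = k")
    case True
    then show ?thesis unfolding UW using key Bv W(3) by blast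
  next
    case False
    then have j: "j < k" using that by simp
    then obtain a where "B *\<^sub>v unit_vec n j = a \<cdot>\<^sub>v unit_vec n j" using U by (auto simp: B_def)
    then show ?thesis unfolding UW using key[of j a] W(4)[of j] v0[of j] j k by auto
  qed
  then show ?case
    using U W unitary_mat_mult[of U n W] by (intro bexI[of _ "U * W"]) auto
qed

text \<open>Once all \<open>n\<close> unit vectors are eigenvectors of the conjugated matrix, it is
  diagonal, and being Hermitian it has a real diagonal.\<close>

theorem spectral_theorem:
  fixes A :: "complex mat"
  assumes A: "A \<in> carrier_mat n n" "hermitian_mat A"
  obtains U d where "U \<in> carrier_mat n n" "unitary_mat U"
    "A = U * mat_diag n (\<lambda>i. of_real (d i)) * mat_adjoint U"
proof -
  obtain U where U: "U \<in> carrier_mat n n" "unitary_mat U"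
    "\<And>j. j < n \<Longrightarrow> \<exists>c. (mat_adjoint U * A * U) *\<^sub>v unit_vec n j = c \<cdot>\<^sub>v unit_vec n j"
    using spectral_partial[OF A, of n] by auto
  define B where "B = mat_adjoint U * A * U"
  have B: "B \<in> carrier_mat n n" using A U by (simp add: B_def)
  have hB: "hermitian_mat B" unfolding B_def using A U by (intro hermitian_conjugation)
  define d where "d = (\<lambda>i. Re (B $$ (i, i)))"
  have "B = mat_diag n (\<lambda>i. of_real (d i))"
  proof (rule eq_matI)
    fix i j assume "i < dim_row (mat_diag n (\<lambda>i. of_real (d i) :: complex))"
      "j < dim_col (mat_diag n (\<lambda>i. of_real (d i) :: complex))"
    then have ij: "i < n" "j < n" by (auto simp: mat_diag_def)
    obtain c where "B *\<^sub>v unit_vec n j = c \<cdot>\<^sub>v unit_vec n j" using U ij by (auto simp: B_def)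
    then have "(B *\<^sub>v unit_vec n j) $ i = (c \<cdot>\<^sub>v unit_vec n j) $ i" by simp
    then have off: "i \<noteq> j \<Longrightarrow> B $$ (i, j) = 0" using ij B by (simp add: scalar_prod_right_unit)
    have "B $$ (i, i) = cnj (B $$ (i, i))"
      using hermitian_matD(1)[OF hB] adjoint_index[of i B i] ij B by simp
    then have "B $$ (i, i) = of_real (d i)" by (simp add: d_def complex_eq_iff)
    then show "B $$ (i, j) = mat_diag n (\<lambda>i. of_real (d i)) $$ (i, j)"
      using off ij by (auto simp: mat_diag_def)
  qed (use B in \<open>auto simp: mat_diag_def\<close>)
  moreover have "A = U * B * mat_adjoint U"
    using A U unitary_matD[OF U(2,1)] unfolding B_def
    by (simp add: assoc_mult_mat[of _ n n _ n _ n] mult_cancel_middle[of _ _ n])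
  ultimately show ?thesis using that U by auto
qed

section \<open>Positive semidefinite matrices\<close>

lemma psd_mat_hermitian: "psd_mat A \<Longrightarrow> hermitian_mat A"
  by (simp add: psd_mat_def)

lemma psd_mat_form:
  "psd_mat A \<Longrightarrow> A \<in> carrier_mat n n \<Longrightarrow> v \<in> carrier_vec n \<Longrightarrow> 0 \<le> (A *\<^sub>v v) \<bullet>c v"
  by (auto simp: psd_mat_def)

lemma psd_mat_conjugation:
  assumes "psd_mat A" and A: "A \<in> carrier_mat n n" and B: "B \<in> carrier_mat n n"
  shows "psd_mat (mat_adjoint B * A * B)"
  unfolding psd_mat_def
proof (intro conjI ballI)
  show "hermitian_mat (mat_adjoint B * A * B)"
    using assms psd_mat_hermitian by (intro hermitian_conjugation)
  fix v :: "complex vec" assume "v \<in> carrier_vec (dim_row (mat_adjoint B * A * B))"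
  then have v: "v \<in> carrier_vec n" using B by simp
  have "((mat_adjoint B * A * B) *\<^sub>v v) \<bullet>c v = (mat_adjoint B *\<^sub>v (A *\<^sub>v (B *\<^sub>v v))) \<bullet>c v"
    using A B v by (simp add: assoc_mult_mat_vec[of _ n n _ n])
  also have "\<dots> = (A *\<^sub>v (B *\<^sub>v v)) \<bullet>c (B *\<^sub>v v)"
    using A B v by (subst cscalar_prod_adjoint[of _ n n]) auto
  finally show "0 \<le> ((mat_adjoint B * A * B) *\<^sub>v v) \<bullet>c v"
    using psd_mat_form[OF assms(1) A, of "B *\<^sub>v v"] B v by simp
qed

lemma psd_mat_conjugation':
  assumes "psd_mat A" and A: "A \<in> carrier_mat n n" and B: "B \<in> carrier_mat n n"
  shows "psd_mat (B * A * mat_adjoint B)"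
  using psd_mat_conjugation[OF assms(1) A, of "mat_adjoint B"] B by simp

lemma psd_mat_add:
  assumes "psd_mat A" "psd_mat B" and A: "A \<in> carrier_mat n n" and B: "B \<in> carrier_mat n n"
  shows "psd_mat (A + B)"
  unfolding psd_mat_def
proof (intro conjI ballI)
  show "hermitian_mat (A + B)"
    using assms by (simp add: psd_mat_def hermitian_mat_def adjoint_add[of _ n n])
  fix v :: "complex vec" assume "v \<in> carrier_vec (dim_row (A + B))"
  then have v: "v \<in> carrier_vec n" using B by simp
  have "((A + B) *\<^sub>v v) \<bullet>c v = (A *\<^sub>v v) \<bullet>c v + (B *\<^sub>v v) \<bullet>c v"
    using A B v by (simp add: add_mult_distrib_mat_vec[of _ n n] add_scalar_prod_distrib[of _ n])
  then show "0 \<le> ((A + B) *\<^sub>v v) \<bullet>c v"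
    using psd_mat_form[OF assms(1) A v] psd_mat_form[OF assms(2) B v] by simp
qed

lemma psd_mat_one: "psd_mat (1\<^sub>m n)"
  by (auto simp: psd_mat_def hermitian_mat_def)

lemma psd_mat_gram:
  assumes "X \<in> carrier_mat n n"
  shows "psd_mat (mat_adjoint X * X)"
  using psd_mat_conjugation[OF psd_mat_one[of n] one_carrier_mat assms] assms by simp

lemma form_unit_vec:
  fixes A :: "complex mat"
  assumes "A \<in> carrier_mat n n" "i < n" "j < n"
  shows "(A *\<^sub>v unit_vec n j) \<bullet>c unit_vec n i = A $$ (i, j)"
proof -
  have "conjugate (unit_vec n i :: complex vec) = unit_vec n i"
    by (intro eq_vecI) (auto simp: unit_vec_def)
  then show ?thesis using assms by (simp add: scalar_prod_right_unit)
qed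

lemma psd_mat_diag_entry:
  assumes "psd_mat A" "A \<in> carrier_mat n n" "i < n"
  shows "0 \<le> A $$ (i, i)"
  using psd_mat_form[OF assms(1,2), of "unit_vec n i"] form_unit_vec[OF assms(2), of i i] assms(3)
  by simp

lemma psd_mat_diag:
  assumes "\<And>i. i < n \<Longrightarrow> 0 \<le> d i"
  shows "psd_mat (mat_diag n (\<lambda>i. complex_of_real (d i)))"
  unfolding psd_mat_def
proof (intro conjI ballI)
  show "hermitian_mat (mat_diag n (\<lambda>i. complex_of_real (d i)))"
    by (simp add: hermitian_mat_def adjoint_mat_diag)
  fix v :: "complex vec" assume "v \<in> carrier_vec (dim_row (mat_diag n (\<lambda>i. complex_of_real (d i))))"
  then have v: "v \<in> carrier_vec n" by (simp add: mat_diag_def)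
  have *: "(mat_diag n (\<lambda>i. complex_of_real (d i)) *\<^sub>v v) $ i = of_real (d i) * v $ i" if "i < n" for i
  proof -
    have "(mat_diag n (\<lambda>i. complex_of_real (d i)) *\<^sub>v v) $ i =
        (\<Sum>j<n. (if i = j then of_real (d j) else 0) * v $ j)"
      using that v by (simp add: mat_diag_def scalar_prod_def atLeast0LessThan)
    also have "\<dots> = (\<Sum>j<n. if i = j then of_real (d j) * v $ j else 0)" by (intro sum.cong) auto
    finally show ?thesis using that by simp
  qed
  have "(mat_diag n (\<lambda>i. complex_of_real (d i)) *\<^sub>v v) \<bullet>c v = (\<Sum>i<n. of_real (d i) * (v $ i * cnj (v $ i)))"
    using v * by (simp add: scalar_prod_def atLeast0LessThan mult.assoc)
  also have "\<dots> = of_real (\<Sum>i<n. d i * cmod (v $ i) ^ 2)"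
    by (simp add: complex_norm_square del: of_real_power)
  finally show "0 \<le> (mat_diag n (\<lambda>i. complex_of_real (d i)) *\<^sub>v v) \<bullet>c v"
    using assms by (auto simp: less_eq_complex_def simp del: of_real_sum intro!: sum_nonneg mult_nonneg_nonneg)
qed

lemma conj_unitary_cancel:
  fixes U :: "complex mat"
  assumes "unitary_mat U" "U \<in> carrier_mat n n" "D \<in> carrier_mat n n"
  shows "mat_adjoint U * (U * D * mat_adjoint U) * U = D"
  using assms unitary_matD[OF assms(1,2)]
  by (simp add: assoc_mult_mat[of _ n n _ n _ n] mult_cancel_middle[of _ _ n])

lemma det_conj_unitary:
  assumes "unitary_mat U" "U \<in> carrier_mat n n" "D \<in> carrier_mat n n"
  shows "det (U * D * mat_adjoint U) = det D"
proof -
  have "det U * det (mat_adjoint U) = 1"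
    using arg_cong[OF unitary_matD(2)[OF assms(1,2)], of det] assms by (simp add: det_mult[of _ n])
  then show ?thesis using assms by (simp add: det_mult[of _ n])
qed

text \<open>The eigenvalues are diagonal entries of a unitary conjugate of \<open>A\<close>, which
  is again positive semidefinite.\<close>

lemma psd_mat_spectral:
  assumes "psd_mat A" "A \<in> carrier_mat n n"
  obtains U d where "U \<in> carrier_mat n n" "unitary_mat U" "\<And>i. i < n \<Longrightarrow> 0 \<le> d i"
    "A = U * mat_diag n (\<lambda>i. of_real (d i)) * mat_adjoint U"
proof -
  obtain U d where U: "U \<in> carrier_mat n n" "unitary_mat U"
    "A = U * mat_diag n (\<lambda>i. of_real (d i)) * mat_adjoint U"
    using spectral_theorem[OF assms(2) psd_mat_hermitian[OF assms(1)]] by blast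
  have "mat_adjoint U * A * U = mat_diag n (\<lambda>i. of_real (d i))"
    unfolding U(3) using U by (intro conj_unitary_cancel) auto
  then have "psd_mat (mat_diag n (\<lambda>i. complex_of_real (d i)))"
    using psd_mat_conjugation[OF assms U(1)] by simp
  then have "0 \<le> d i" if "i < n" for i
    using psd_mat_diag_entry[of _ n i] that by (fastforce simp: mat_diag_def less_eq_complex_def)
  then show ?thesis using that U by blast
qed

lemma det_psd_nonneg:
  assumes "psd_mat A" "A \<in> carrier_mat n n"
  shows "0 \<le> det A"
proof -
  obtain U d where U: "U \<in> carrier_mat n n" "unitary_mat U" "\<And>i. i < n \<Longrightarrow> 0 \<le> d i"
    "A = U * mat_diag n (\<lambda>i. of_real (d i)) * mat_adjoint U"
    using psd_mat_spectral[OF assms] by metis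
  then have "det A = of_real (\<Prod>i<n. d i)"
    by (simp add: det_conj_unitary[of _ n] det_mat_diag)
  then show ?thesis using U(3) by (auto simp: less_eq_complex_def simp del: of_real_prod intro!: prod_nonneg)
qed

section \<open>Square roots and polar decompositions\<close>

text \<open>In eigenbases, \<open>T\<close> intertwines the squared diagonals \<open>D * D\<close>
  and \<open>E * E\<close>. A nonzero entry of \<open>T\<close> at \<open>(i, j)\<close> thus forces
  equal squares of \<open>b i\<close> and \<open>c j\<close>, and by nonnegativity
  \<open>b i = c j\<close>; so \<open>T\<close> intertwines \<open>D\<close> and \<open>E\<close>
  themselves.\<close>

lemma psd_sqrt_unique:
  assumes "psd_mat B" "B \<in> carrier_mat n n" "psd_mat C" "C \<in> carrier_mat n n" "B * B = C * C"
  shows "B = C"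
proof -
  obtain U b where U: "U \<in> carrier_mat n n" "unitary_mat U" "\<And>i. i < n \<Longrightarrow> 0 \<le> b i"
    "B = U * mat_diag n (\<lambda>i. of_real (b i)) * mat_adjoint U"
    using psd_mat_spectral[OF assms(1,2)] by metis
  obtain W c where W: "W \<in> carrier_mat n n" "unitary_mat W" "\<And>i. i < n \<Longrightarrow> 0 \<le> c i"
    "C = W * mat_diag n (\<lambda>i. of_real (c i)) * mat_adjoint W"
    using psd_mat_spectral[OF assms(3,4)] by metis
  define D where "D = mat_diag n (\<lambda>i. complex_of_real (b i))"
  define E where "E = mat_diag n (\<lambda>i. complex_of_real (c i))"
  define T where "T = mat_adjoint U * W"
  have D: "D \<in> carrier_mat n n" and E: "E \<in> carrier_mat n n" and T: "T \<in> carrier_mat n n"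
    using U W by (auto simp: D_def E_def T_def)
  note defs = U(4)[folded D_def] W(4)[folded E_def]
  note un = unitary_matD[OF U(2,1)] unitary_matD[OF W(2,1)]
  note assoc = assoc_mult_mat[of _ n n _ n _ n] mult_cancel_middle[of _ _ n]
  have "D * D * T = mat_adjoint U * (B * B) * W"
    unfolding defs T_def using U W D by (simp add: assoc un)
  also have "\<dots> = T * (E * E)"
    unfolding assms(5) unfolding defs T_def using U W E by (simp add: assoc un)
  finally have sq: "D * D * T = T * (E * E)" .
  have "D * T = T * E"
  proof (rule eq_matI)
    fix i j assume "i < dim_row (T * E)" "j < dim_col (T * E)"
    then have ij: "i < n" "j < n" using T E by auto
    have "(D * D * T) $$ (i, j) = of_real (b i * b i) * T $$ (i, j)"
      using ij T by (simp add: D_def mat_diag_mult_left[of _ n n])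
    moreover have "(T * (E * E)) $$ (i, j) = T $$ (i, j) * of_real (c j * c j)"
      using ij T by (simp add: E_def mat_diag_mult_right[of _ n n])
    ultimately have "T $$ (i, j) = 0 \<or> of_real (b i * b i) = (of_real (c j * c j) :: complex)"
      using sq by (metis mult.commute mult_left_cancel)
    then have "T $$ (i, j) = 0 \<or> b i * b i = c j * c j" using of_real_eq_iff by blast
    then have "T $$ (i, j) = 0 \<or> b i = c j"
      using U(3)[OF ij(1)] W(3)[OF ij(2)] by (metis abs_of_nonneg real_sqrt_mult_self real_sqrt_abs2)
    then show "(D * T) $$ (i, j) = (T * E) $$ (i, j)"
      using ij T by (auto simp: D_def E_def mat_diag_mult_left[of _ n n] mat_diag_mult_right[of _ n n])
  qed (use D E T in auto)
  then have "U * (D * T) * mat_adjoint W = U * (T * E) * mat_adjoint W" by simp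
  then show ?thesis
    unfolding defs T_def using U W D E by (simp add: assoc un)
qed

lemma psd_sqrt_eqI:
  assumes "psd_mat B" "B \<in> carrier_mat n n" "B * B = A"
  shows "psd_sqrt A = B"
  unfolding psd_sqrt_def
proof (rule the_equality)
  fix C assume C: "psd_mat C \<and> C * C = A"
  \<comment> \<open>The competitor comes without a size: it is square because it is Hermitian, and
    its square has the size of \<open>A\<close>.\<close>
  then have "C \<in> carrier_mat n n"
    using assms hermitian_matD(2)[OF psd_mat_hermitian, of C]
    by (metis carrier_matD(1) carrier_matI index_mult_mat(2))
  then show "C = B" using psd_sqrt_unique[of C n B] C assms by auto
qed (use assms in auto)

lemma mat_diag_sqrt_square:
  assumes "\<And>i. i < n \<Longrightarrow> 0 \<le> d i"
  shows "mat_diag n (\<lambda>i. complex_of_real (sqrt (d i))) * mat_diag n (\<lambda>i. complex_of_real (sqrt (d i)))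
    = mat_diag n (\<lambda>i. complex_of_real (d i))"
  unfolding mat_diag_diag of_real_mult[symmetric]
  using assms by (intro eq_matI) (auto simp: mat_diag_def)

lemma psd_sqrt_spectral:
  assumes U: "U \<in> carrier_mat n n" "unitary_mat U" and d: "\<And>i. i < n \<Longrightarrow> 0 \<le> d i"
  shows "psd_sqrt (U * mat_diag n (\<lambda>i. of_real (d i)) * mat_adjoint U) =
    U * mat_diag n (\<lambda>i. of_real (sqrt (d i))) * mat_adjoint U" (is "_ = ?R")
    and "psd_mat (U * mat_diag n (\<lambda>i. of_real (sqrt (d i))) * mat_adjoint U)"
proof -
  show psd: "psd_mat ?R"
    using U d by (intro psd_mat_conjugation'[of _ n] psd_mat_diag) auto
  have "?R * ?R = U * (mat_diag n (\<lambda>i. of_real (sqrt (d i))) * mat_diag n (\<lambda>i. of_real (sqrt (d i)))) * mat_adjoint U"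
    using U unitary_matD[OF U(2,1)]
    by (simp add: assoc_mult_mat[of _ n n _ n _ n] mult_cancel_middle[of _ _ n] del: mat_diag_diag)
  also have "\<dots> = U * mat_diag n (\<lambda>i. of_real (d i)) * mat_adjoint U"
    using mat_diag_sqrt_square[OF d] by simp
  finally show "psd_sqrt (U * mat_diag n (\<lambda>i. of_real (d i)) * mat_adjoint U) = ?R"
    using psd U by (intro psd_sqrt_eqI[of _ n]) auto
qed

section \<open>Moduli and the existence of polar decompositions\<close>

lemma psd_mat_modulus:
  assumes X: "X \<in> carrier_mat n n"
  shows "psd_mat (mat_modulus X)" "mat_modulus X \<in> carrier_mat n n"
proof -
  obtain U d where U: "U \<in> carrier_mat n n" "unitary_mat U" "\<And>i. i < n \<Longrightarrow> 0 \<le> d i"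
    "mat_adjoint X * X = U * mat_diag n (\<lambda>i. of_real (d i)) * mat_adjoint U"
    using psd_mat_spectral[OF psd_mat_gram[OF X]] X by (metis adjoint_carrier mult_carrier_square)
  show "psd_mat (mat_modulus X)" "mat_modulus X \<in> carrier_mat n n"
    unfolding mat_modulus_def U(4) using psd_sqrt_spectral[of U n d] U by auto
qed

text \<open>Vanishing columns of Y are replaced one at a time by a unit vector in the kernel of the
  adjoint of Y, until the columns can be normalised.\<close>

lemma orthogonal_columns_factorisation:
  assumes "Y \<in> carrier_mat n n" "mat_adjoint Y * Y = mat_diag n (\<lambda>i. of_real (d i))"
    "\<And>i. i < n \<Longrightarrow> 0 \<le> d i"
  shows "\<exists>V \<in> carrier_mat n n. unitary_mat V \<and> Y = V * mat_diag n (\<lambda>i. of_real (sqrt (d i)))"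
  using assms
proof (induction "card {i. i < n \<and> d i = 0}" arbitrary: Y d)
  case 0
  then have pos: "0 < d i" if "i < n" for i
  proof -
    have "{i. i < n \<and> d i = 0} = {}" using 0(1) by simp
    then have "d i \<noteq> 0" using that by blast
    then show ?thesis using 0(4)[OF that] by simp
  qed
  \<comment> \<open>All columns are nonzero here; \<open>D\<close> divides each of them by its
    length.\<close>
  define D where "D = mat_diag n (\<lambda>i. complex_of_real (1 / sqrt (d i)))"
  have D: "D \<in> carrier_mat n n" "mat_adjoint D = D" by (auto simp: D_def adjoint_mat_diag)
  have "mat_adjoint (Y * D) * (Y * D) = D * (mat_adjoint Y * Y) * D"
    using D 0(2) by (simp add: adjoint_mult[of _ n n _ n] assoc_mult_mat[of _ n n _ n _ n])
  also have "\<dots> = mat_diag n (\<lambda>i. complex_of_real (1 / sqrt (d i) * d i * (1 / sqrt (d i))))"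
    unfolding 0(3) D_def mat_diag_diag of_real_mult ..
  also have "\<dots> = 1\<^sub>m n"
    using pos by (intro eq_matI) (auto simp: mat_diag_def real_div_sqrt less_imp_le less_le)
  finally have "unitary_mat (Y * D)" using D 0 by (intro unitary_matI[of _ n]) auto
  moreover have "D * mat_diag n (\<lambda>i. of_real (sqrt (d i))) = 1\<^sub>m n"
    unfolding D_def mat_diag_diag using pos by (intro eq_matI) (auto simp: mat_diag_def less_le)
  ultimately show ?case
    using D 0 by (intro bexI[of _ "Y * D"]) (auto simp: assoc_mult_mat[of _ n n _ n _ n])
next
  case (Suc m)
  note Y = Suc.prems(1) and YY = Suc.prems(2)
  have "{i. i < n \<and> d i = 0} \<noteq> {}" using Suc.hyps(2) by (metis card.empty Zero_not_Suc)
  then obtain i where i: "i < n" "d i = 0" by blast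
  have YY_entry: "(\<Sum>l<n. cnj (Y $$ (l, a)) * Y $$ (l, b)) = (if a = b then of_real (d b) else 0)"
    if "a < n" "b < n" for a b
    using arg_cong[OF YY, of "\<lambda>M. M $$ (a, b)"] that Y
    by (simp add: scalar_prod_def atLeast0LessThan mat_diag_def)
  \<comment> \<open>Column \<open>i\<close> has squared length \<open>d i = 0\<close>, so
    \<open>Y\<close> is singular and so is its adjoint. A kernel vector of the adjoint is orthogonal
    to all columns of \<open>Y\<close>.\<close>
  have "of_real (\<Sum>l<n. cmod (Y $$ (l, i)) ^ 2) = (0 :: complex)"
    using YY_entry[of i i] i by (simp add: complex_norm_square mult.commute del: of_real_power)
  then have "(\<Sum>l<n. cmod (Y $$ (l, i)) ^ 2) = 0" using of_real_eq_0_iff by blast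
  then have col0: "Y $$ (l, i) = 0" if "l < n" for l
    using that by (simp add: sum_nonneg_eq_0_iff)
  have "Y *\<^sub>v unit_vec n i = 0\<^sub>v n"
    using Y i col0 by (intro eq_vecI) (auto simp: mult_mat_unit_vec[of _ n])
  then have "det Y = 0"
    using det_0_iff_vec_prod_zero[OF Y] i by (metis unit_vec_carrier unit_vec_nonzero)
  then have "det (mat_adjoint Y) = 0" using det_adjoint[OF Y] by simp
  then obtain u0 where u0: "u0 \<in> carrier_vec n" "u0 \<noteq> 0\<^sub>v n" "mat_adjoint Y *\<^sub>v u0 = 0\<^sub>v n"
    using det_0_iff_vec_prod_zero[of "mat_adjoint Y" n] Y by auto
  obtain c where c: "(c \<cdot>\<^sub>v u0) \<bullet>c (c \<cdot>\<^sub>v u0) = 1"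
    using normalize_vec[OF u0(1,2) i(1)] by auto
  define u where "u = c \<cdot>\<^sub>v u0"
  have u: "u \<in> carrier_vec n" using u0 by (simp add: u_def)
  have u1: "(\<Sum>l<n. cnj (u $ l) * u $ l) = 1"
    using c u unfolding u_def[symmetric] by (simp add: scalar_prod_def atLeast0LessThan mult.commute)
  have "mat_adjoint Y *\<^sub>v u = 0\<^sub>v n" 
    unfolding u_def mult_mat_vec[OF adjoint_carrier[OF Y] u0(1)] u0(3) by (intro eq_vecI) auto
  then have uY: "(\<Sum>l<n. cnj (Y $$ (l, b)) * u $ l) = 0" if "b < n" for b
  proof -
    have "(mat_adjoint Y *\<^sub>v u) $ b = (\<Sum>l<n. cnj (Y $$ (l, b)) * u $ l)"
      using that Y u by (simp add: scalar_prod_def atLeast0LessThan)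
    then show ?thesis using \<open>mat_adjoint Y *\<^sub>v u = 0\<^sub>v n\<close> that by simp
  qed
  then have uY': "(\<Sum>l<n. cnj (u $ l) * Y $$ (l, b)) = 0" if "b < n" for b
    using arg_cong[OF uY[OF that], of cnj] by (simp add: mult.commute)
  define Y' where "Y' = mat n n (\<lambda>(r, c). if c = i then u $ r else Y $$ (r, c))"
  \<comment> \<open>The new column has length one, so one zero of \<open>d\<close>
    disappears.\<close>
  define d' where "d' = d(i := 1)"
  have Y': "Y' \<in> carrier_mat n n" by (simp add: Y'_def)
  have "mat_adjoint Y' * Y' = mat_diag n (\<lambda>i. of_real (d' i))"
  proof (rule eq_matI)
    fix a b assume "a < dim_row (mat_diag n (\<lambda>i. complex_of_real (d' i)))"
      "b < dim_col (mat_diag n (\<lambda>i. complex_of_real (d' i)))"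
    then have ab: "a < n" "b < n" by (auto simp: mat_diag_def)
    have "(mat_adjoint Y' * Y') $$ (a, b) = (\<Sum>l<n. cnj (Y' $$ (l, a)) * Y' $$ (l, b))"
      using ab Y' by (simp add: scalar_prod_def atLeast0LessThan)
    also have "\<dots> = (if a = b then of_real (d' b) else 0)"
      using ab YY_entry[OF ab] u1 uY uY' by (cases "a = i"; cases "b = i") (auto simp: Y'_def d'_def)
    finally show "(mat_adjoint Y' * Y') $$ (a, b) = mat_diag n (\<lambda>i. complex_of_real (d' i)) $$ (a, b)"
      using ab by (simp add: mat_diag_def)
  qed (use Y' in \<open>auto simp: mat_diag_def\<close>)
  moreover have "m = card {i. i < n \<and> d' i = 0}"
  proof -
    have "{i. i < n \<and> d' i = 0} = {i. i < n \<and> d i = 0} - {i}" by (auto simp: d'_def)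
    then show ?thesis using Suc.hyps(2) i by simp
  qed
  moreover have "0 \<le> d' j" if "j < n" for j using Suc.prems(3) that by (simp add: d'_def)
  ultimately obtain V where V: "V \<in> carrier_mat n n" "unitary_mat V"
    "Y' = V * mat_diag n (\<lambda>i. of_real (sqrt (d' i)))"
    using Suc.hyps(1)[of d' Y'] Y' by auto
  \<comment> \<open>Columns other than \<open>i\<close> were not changed, and in column
    \<open>i\<close> both sides vanish because \<open>d i = 0\<close>.\<close>
  have "Y = V * mat_diag n (\<lambda>i. of_real (sqrt (d i)))"
  proof (rule eq_matI)
    fix r k assume "r < dim_row (V * mat_diag n (\<lambda>i. of_real (sqrt (d i))))"
      "k < dim_col (V * mat_diag n (\<lambda>i. of_real (sqrt (d i))))"
    then have rk: "r < n" "k < n" using V by (auto simp: mat_diag_def)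
    have "Y' $$ (r, k) = V $$ (r, k) * of_real (sqrt (d' k))"
      unfolding V(3) using V(1) rk by (simp add: mat_diag_mult_right[of _ n n])
    then show "Y $$ (r, k) = (V * mat_diag n (\<lambda>i. of_real (sqrt (d i)))) $$ (r, k)"
      using V(1) rk i col0 by (auto simp: mat_diag_mult_right[of _ n n] Y'_def d'_def split: if_splits)
  qed (use Y V in \<open>auto simp: mat_diag_def\<close>)
  then show ?case using V by blast
qed

text \<open>If \<open>W\<close> diagonalises the Gram matrix of \<open>X\<close>, then
  \<open>X * W\<close> has orthogonal columns and factors as a unitary \<open>V\<close> times the
  diagonal of singular values. Undoing \<open>W\<close> leaves \<open>V * mat_adjoint W\<close> as
  the unitary factor.\<close>

theorem polar_decomposition_exists:
  assumes X: "X \<in> carrier_mat n n"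
  obtains U where "U \<in> carrier_mat n n" "polar_decomposition X U"
proof -
  obtain W d where W: "W \<in> carrier_mat n n" "unitary_mat W" "\<And>i. i < n \<Longrightarrow> 0 \<le> d i"
    "mat_adjoint X * X = W * mat_diag n (\<lambda>i. of_real (d i)) * mat_adjoint W"
    using psd_mat_spectral[OF psd_mat_gram[OF X]] X by (metis adjoint_carrier mult_carrier_square)
  have "mat_adjoint (X * W) * (X * W) = mat_adjoint W * (mat_adjoint X * X) * W"
    using X W(1) by (simp add: adjoint_mult[of _ n n _ n] assoc_mult_mat[of _ n n _ n _ n])
  also have "\<dots> = mat_diag n (\<lambda>i. of_real (d i))"
    unfolding W(4) using W by (intro conj_unitary_cancel) auto
  finally obtain V where V: "V \<in> carrier_mat n n" "unitary_mat V"
    "X * W = V * mat_diag n (\<lambda>i. of_real (sqrt (d i)))"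
    using orthogonal_columns_factorisation[of "X * W" n d] X W by auto
  have mod: "mat_modulus X = W * mat_diag n (\<lambda>i. of_real (sqrt (d i))) * mat_adjoint W"
    unfolding mat_modulus_def W(4) using W by (intro psd_sqrt_spectral) auto
  have "X = X * W * mat_adjoint W"
    using X W unitary_matD[OF W(2,1)] by (simp add: assoc_mult_mat[of _ n n _ n _ n])
  also have "\<dots> = V * mat_adjoint W * mat_modulus X"
    unfolding V(3) mod using V W unitary_matD[OF W(2,1)]
    by (simp add: assoc_mult_mat[of _ n n _ n _ n] mult_cancel_middle[of _ _ n])
  finally have "polar_decomposition X (V * mat_adjoint W)"
    using V W unitary_mat_mult[of V n "mat_adjoint W"] unitary_mat_adjoint[of W n]
    by (simp add: polar_decomposition_def)
  then show ?thesis using that[of "V * mat_adjoint W"] V(1) W(1) by simp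
qed

section \<open>Cauchy-Schwarz for determinants\<close>

lemma form_conjugation:
  fixes A :: "complex mat"
  assumes "A \<in> carrier_mat n n" "U \<in> carrier_mat n n" "W \<in> carrier_mat n n"
    "x \<in> carrier_vec n" "y \<in> carrier_vec n"
  shows "((mat_adjoint W * A * U) *\<^sub>v y) \<bullet>c x = (A *\<^sub>v (U *\<^sub>v y)) \<bullet>c (W *\<^sub>v x)"
proof -
  have "((mat_adjoint W * A * U) *\<^sub>v y) \<bullet>c x = (mat_adjoint W *\<^sub>v (A *\<^sub>v (U *\<^sub>v y))) \<bullet>c x"
    using assms by (simp add: assoc_mult_mat_vec[of _ n n _ n])
  also have "\<dots> = (A *\<^sub>v (U *\<^sub>v y)) \<bullet>c (W *\<^sub>v x)"
    using assms by (subst cscalar_prod_adjoint[of _ n n]) auto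
  finally show ?thesis .
qed

text \<open>Positivity at \<open>x - t y\<close>, where \<open>t\<close> is \<open>s\<close> times
  the mixed value \<open>b\<close>, is a quadratic inequality in the real number \<open>s\<close>;
  the choice \<open>s = 1 / c\<close> gives the bound. If \<open>c = 0\<close>, the inequality is
  linear in \<open>s\<close> and forces \<open>b = 0\<close>.\<close>

lemma psd_form_Cauchy_Schwarz:
  assumes "psd_mat P" and P: "P \<in> carrier_mat n n" and x: "x \<in> carrier_vec n" and y: "y \<in> carrier_vec n"
  shows "(cmod ((P *\<^sub>v x) \<bullet>c y))\<^sup>2 \<le> Re ((P *\<^sub>v x) \<bullet>c x) * Re ((P *\<^sub>v y) \<bullet>c y)"
proof -
  define a b c where "a = Re ((P *\<^sub>v x) \<bullet>c x)" and "b = (P *\<^sub>v x) \<bullet>c y" and "c = Re ((P *\<^sub>v y) \<bullet>c y)"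
  have a: "(P *\<^sub>v x) \<bullet>c x = of_real a" "0 \<le> a" and c: "(P *\<^sub>v y) \<bullet>c y = of_real c" "0 \<le> c"
    using psd_mat_form[OF assms(1) P x] psd_mat_form[OF assms(1) P y]
    by (auto simp: a_def c_def less_eq_complex_def complex_eq_iff)
  have herm: "mat_adjoint P = P" using psd_mat_hermitian[OF assms(1)] by (rule hermitian_matD)
  have "(P *\<^sub>v y) \<bullet>c x = y \<bullet>c (P *\<^sub>v x)"
    using cscalar_prod_adjoint[OF P y x] herm by simp
  also have "\<dots> = conjugate ((P *\<^sub>v x) \<bullet>c y)"
    using P x y conjugate_conjugate_sprod[of "P *\<^sub>v x" n y]
    by (metis conjugate_id conjugate_sprod_vec conjugate_vec_sprod_comm carrier_vec_conjugate mult_mat_vec_carrier)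
  finally have b': "(P *\<^sub>v y) \<bullet>c x = cnj b" by (simp add: b_def)
  have quad: "0 \<le> a - 2 * s * (cmod b)\<^sup>2 + s\<^sup>2 * (cmod b)\<^sup>2 * c" for s :: real
  proof -
    define t where "t = of_real s * b"
    have "P *\<^sub>v (x - t \<cdot>\<^sub>v y) = P *\<^sub>v x - t \<cdot>\<^sub>v (P *\<^sub>v y)"
      using P x y by (simp add: mult_minus_distrib_mat_vec[of _ n n] mult_mat_vec[of _ n n])
    moreover have "conjugate (x - t \<cdot>\<^sub>v y) = conjugate x - cnj t \<cdot>\<^sub>v conjugate y"
      using x y by (intro eq_vecI) auto
    ultimately have "(P *\<^sub>v (x - t \<cdot>\<^sub>v y)) \<bullet>c (x - t \<cdot>\<^sub>v y) =
        (P *\<^sub>v x) \<bullet>c x - cnj t * ((P *\<^sub>v x) \<bullet>c y) - t * ((P *\<^sub>v y) \<bullet>c x) + t * cnj t * ((P *\<^sub>v y) \<bullet>c y)"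
      using P x y
      by (simp add: minus_scalar_prod_distrib[of _ n] scalar_prod_minus_distrib[of _ n] algebra_simps)
    also have "\<dots> = of_real (a - 2 * s * (cmod b)\<^sup>2 + s\<^sup>2 * (cmod b)\<^sup>2 * c)"
      unfolding b' a c b_def[symmetric] t_def
      unfolding of_real_add of_real_diff of_real_mult complex_norm_square
      by (simp add: power2_eq_square[of "complex_of_real s"] algebra_simps)
    finally show ?thesis
      using psd_mat_form[OF assms(1) P, of "x - t \<cdot>\<^sub>v y"] x y by (simp add: less_eq_complex_def)
  qed
  have "(cmod b)\<^sup>2 \<le> a * c"
  proof (cases "c = 0")
    case True
    have "cmod b = 0"
    proof (rule ccontr)
      assume "cmod b \<noteq> 0"
      then show False using quad[of "(a + 1) / (2 * (cmod b)\<^sup>2)"] True a(2) by (simp add: field_simps)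
    qed
    then show ?thesis using True by simp
  next
    case False
    then show ?thesis using quad[of "1 / c"] c(2) by (simp add: field_simps power2_eq_square)
  qed
  then show ?thesis by (simp add: a_def b_def c_def)
qed

lemma det_eq_0_of_kernel:
  fixes A :: "complex mat"
  assumes "A \<in> carrier_mat n n" "v \<in> carrier_vec n" "v \<noteq> 0\<^sub>v n" "A *\<^sub>v v = 0\<^sub>v n"
  shows "det A = 0"
  using det_0_iff_vec_prod_zero[OF assms(1)] assms by auto

text \<open>The squared modulus of the determinant is the product of the eigenvalues
  \<open>d i\<close> of the Gram matrix. Testing the hypothesis on a unit eigenvector
  \<open>y\<close> and on \<open>x = B y\<close> gives that the square of \<open>d i\<close> is at
  most \<open>d i\<close>.\<close>

lemma det_contraction:
  fixes B :: "complex mat"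
  assumes B: "B \<in> carrier_mat n n"
    and contr: "\<And>x y. x \<in> carrier_vec n \<Longrightarrow> y \<in> carrier_vec n \<Longrightarrow>
      (cmod ((B *\<^sub>v y) \<bullet>c x))\<^sup>2 \<le> Re (x \<bullet>c x) * Re (y \<bullet>c y)"
  shows "cmod (det B) \<le> 1"
proof -
  obtain U d where U: "U \<in> carrier_mat n n" "unitary_mat U" "\<And>i. i < n \<Longrightarrow> 0 \<le> d i"
    "mat_adjoint B * B = U * mat_diag n (\<lambda>i. of_real (d i)) * mat_adjoint U"
    using psd_mat_spectral[OF psd_mat_gram[OF B]] B by (metis adjoint_carrier mult_carrier_square)
  have "d i \<le> 1" if i: "i < n" for i
  proof -
    define y where "y = U *\<^sub>v unit_vec n i"
    have y: "y \<in> carrier_vec n" using U by (simp add: y_def)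
    have "(B *\<^sub>v y) \<bullet>c (B *\<^sub>v y) = ((mat_adjoint B * 1\<^sub>m n * B) *\<^sub>v y) \<bullet>c y"
      using B y by (subst form_conjugation[of _ n]) auto
    also have "\<dots> = ((mat_adjoint B * B) *\<^sub>v y) \<bullet>c y" using B by simp
    also have "\<dots> = ((mat_adjoint U * (mat_adjoint B * B) * U) *\<^sub>v unit_vec n i) \<bullet>c unit_vec n i"
      unfolding y_def using B U(1) by (subst form_conjugation[of _ n]) auto
    also have "mat_adjoint U * (mat_adjoint B * B) * U = mat_diag n (\<lambda>i. of_real (d i))"
      unfolding U(4) using U by (intro conj_unitary_cancel) auto
    also have "(mat_diag n (\<lambda>i. complex_of_real (d i)) *\<^sub>v unit_vec n i) \<bullet>c unit_vec n i = of_real (d i)"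
      using i by (subst form_unit_vec) (auto simp: mat_diag_def)
    finally have By: "(B *\<^sub>v y) \<bullet>c (B *\<^sub>v y) = of_real (d i)" .
    have "y \<bullet>c y = ((mat_adjoint U * 1\<^sub>m n * U) *\<^sub>v unit_vec n i) \<bullet>c unit_vec n i"
      unfolding y_def using U(1) by (subst form_conjugation[of _ n]) auto
    also have "mat_adjoint U * 1\<^sub>m n * U = 1\<^sub>m n" using U(1) unitary_matD[OF U(2,1)] by simp
    also have "(1\<^sub>m n *\<^sub>v unit_vec n i) \<bullet>c unit_vec n i = (1 :: complex)"
      using i by (subst form_unit_vec) auto
    finally have "y \<bullet>c y = 1" .
    then have "(d i)\<^sup>2 \<le> d i"
      using contr[of "B *\<^sub>v y" y] B y By by simp
    then show ?thesis using U(3)[OF i] by (cases "d i = 0") (auto simp: power2_eq_square)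
  qed
  then have "(\<Prod>i<n. d i) \<le> 1" using U(3) by (intro prod_le_1) auto
  moreover have "det (mat_adjoint B * B) = of_real (\<Prod>i<n. d i)"
    unfolding U(4) using U(1,2) by (simp add: det_conj_unitary[of _ n] det_mat_diag)
  moreover have "det (mat_adjoint B * B) = of_real ((cmod (det B))\<^sup>2)"
    using B by (simp add: det_mult[of _ n] det_adjoint[of _ n] complex_norm_square mult.commute del: of_real_power)
  ultimately have "(cmod (det B))\<^sup>2 \<le> 1" by (metis of_real_eq_iff)
  then show ?thesis by (simp add: abs_square_le_1)
qed

text \<open>The columns of \<open>S\<close> are the eigenvectors of \<open>A\<close>, each divided
  by the square root of its eigenvalue.\<close>

lemma psd_congruent_to_one:
  assumes A: "psd_mat A" "A \<in> carrier_mat n n" "det A \<noteq> 0"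
  obtains S where "S \<in> carrier_mat n n" "mat_adjoint S * A * S = 1\<^sub>m n"
proof -
  obtain U d where U: "U \<in> carrier_mat n n" "unitary_mat U" "\<And>i. i < n \<Longrightarrow> 0 \<le> d i"
    "A = U * mat_diag n (\<lambda>i. of_real (d i)) * mat_adjoint U"
    using psd_mat_spectral[OF A(1,2)] by metis
  have "det A = (\<Prod>i<n. of_real (d i))"
    unfolding U(4) using U(1,2) by (simp add: det_conj_unitary[of _ n] det_mat_diag)
  then have pos: "0 < d i" if "i < n" for i
    using A(3) U(3)[OF that] that by (auto simp: less_le)
  define T where "T = mat_diag n (\<lambda>i. complex_of_real (1 / sqrt (d i)))"
  have T: "T \<in> carrier_mat n n" "mat_adjoint T = T" by (auto simp: T_def adjoint_mat_diag)
  have "mat_adjoint (U * T) * A * (U * T) = T * (mat_adjoint U * A * U) * T"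
    using T U(1) A(2) by (simp add: adjoint_mult[of _ n n _ n] assoc_mult_mat[of _ n n _ n _ n])
  also have "mat_adjoint U * A * U = mat_diag n (\<lambda>i. of_real (d i))"
    unfolding U(4) using U by (intro conj_unitary_cancel) auto
  also have "T * mat_diag n (\<lambda>i. of_real (d i)) * T =
      mat_diag n (\<lambda>i. complex_of_real (1 / sqrt (d i) * d i * (1 / sqrt (d i))))"
    unfolding T_def mat_diag_diag of_real_mult ..
  also have "\<dots> = 1\<^sub>m n"
    using pos by (intro eq_matI) (auto simp: mat_diag_def real_div_sqrt less_imp_le less_le)
  finally show ?thesis using that[of "U * T"] T U(1) by simp
qed

text \<open>For invertible \<open>A\<close> and \<open>D\<close>, congruences normalise both to the
  identity and turn \<open>B\<close> into a contraction. If one of them is singular, its kernel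
  vector is annihilated by the adjoint of \<open>B\<close> or by \<open>B\<close>, so both sides of
  the claim are controlled by \<open>det B = 0\<close>.\<close>

lemma det_form_Cauchy_Schwarz:
  fixes B :: "complex mat"
  assumes A: "psd_mat A" "A \<in> carrier_mat n n" and D: "psd_mat D" "D \<in> carrier_mat n n"
    and B: "B \<in> carrier_mat n n"
    and CS: "\<And>x y. x \<in> carrier_vec n \<Longrightarrow> y \<in> carrier_vec n \<Longrightarrow>
      (cmod ((B *\<^sub>v y) \<bullet>c x))\<^sup>2 \<le> Re ((A *\<^sub>v x) \<bullet>c x) * Re ((D *\<^sub>v y) \<bullet>c y)"
  shows "(cmod (det B))\<^sup>2 \<le> Re (det A) * Re (det D)"
proof (cases "det A = 0 \<or> det D = 0")
  case True
  have "det B = 0"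
  proof (cases "det A = 0")
    case True
    then obtain x where x: "x \<in> carrier_vec n" "x \<noteq> 0\<^sub>v n" "A *\<^sub>v x = 0\<^sub>v n"
      using det_0_iff_vec_prod_zero[OF A(2)] by auto
    \<comment> \<open>With this choice the mixed value is the squared length of \<open>y\<close>,
      while the right side of \<open>CS\<close> is zero.\<close>
    define y where "y = mat_adjoint B *\<^sub>v x"
    have y: "y \<in> carrier_vec n" using mult_mat_vec_carrier[OF adjoint_carrier[OF B] x(1)] by (simp add: y_def)
    have "(B *\<^sub>v y) \<bullet>c x = 0" using CS[OF x(1) y] x by simp
    then have "y \<bullet>c y = 0" using cscalar_prod_adjoint[OF B y x(1)] by (simp add: y_def)
    then have "y = 0\<^sub>v n" using y by simp
    then have "det (mat_adjoint B) = 0"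
      using det_eq_0_of_kernel[of "mat_adjoint B" n x] B x by (simp add: y_def)
    then show ?thesis using det_adjoint[OF B] by simp
  next
    case False
    then obtain y where y: "y \<in> carrier_vec n" "y \<noteq> 0\<^sub>v n" "D *\<^sub>v y = 0\<^sub>v n"
      using det_0_iff_vec_prod_zero[OF D(2)] True by auto
    have By: "B *\<^sub>v y \<in> carrier_vec n" using B y by simp
    have "(B *\<^sub>v y) \<bullet>c (B *\<^sub>v y) = 0" using CS[OF By y(1)] y by simp
    then have "B *\<^sub>v y = 0\<^sub>v n" using By by simp
    then show ?thesis using det_eq_0_of_kernel[OF B y(1,2)] by simp
  qed
  then show ?thesis
    using det_psd_nonneg[OF A] det_psd_nonneg[OF D] by (simp add: less_eq_complex_def)
next
  case False
  obtain S where S: "S \<in> carrier_mat n n" "mat_adjoint S * A * S = 1\<^sub>m n"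
    using psd_congruent_to_one[OF A] False by blast
  obtain T where T: "T \<in> carrier_mat n n" "mat_adjoint T * D * T = 1\<^sub>m n"
    using psd_congruent_to_one[OF D] False by blast
  have "cmod (det (mat_adjoint S * B * T)) \<le> 1"
  proof (rule det_contraction)
    fix x y :: "complex vec" assume xy: "x \<in> carrier_vec n" "y \<in> carrier_vec n"
    have "((mat_adjoint S * B * T) *\<^sub>v y) \<bullet>c x = (B *\<^sub>v (T *\<^sub>v y)) \<bullet>c (S *\<^sub>v x)"
      using form_conjugation[OF B T(1) S(1) xy] .
    moreover have "(A *\<^sub>v (S *\<^sub>v x)) \<bullet>c (S *\<^sub>v x) = x \<bullet>c x"
      using form_conjugation[OF A(2) S(1) S(1) xy(1) xy(1)] xy S by simp
    moreover have "(D *\<^sub>v (T *\<^sub>v y)) \<bullet>c (T *\<^sub>v y) = y \<bullet>c y"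
      using form_conjugation[OF D(2) T(1) T(1) xy(2) xy(2)] xy T by simp
    ultimately show "(cmod (((mat_adjoint S * B * T) *\<^sub>v y) \<bullet>c x))\<^sup>2 \<le> Re (x \<bullet>c x) * Re (y \<bullet>c y)"
      using CS[of "S *\<^sub>v x" "T *\<^sub>v y"] S(1) T(1) xy by simp
  qed (use B S T in auto)
  then have le: "cmod (det S) * cmod (det B) * cmod (det T) \<le> 1"
    using B S(1) T(1) by (simp add: det_mult[of _ n] det_adjoint[of _ n] norm_mult)
  \<comment> \<open>Stated for arbitrary \<open>A\<close> and \<open>S\<close>, since it is applied
    to both normalising congruences.\<close>
  have sA: "(cmod (det S))\<^sup>2 * Re (det A) = 1" if S: "S \<in> carrier_mat n n" "mat_adjoint S * A * S = 1\<^sub>m n"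
    and A: "psd_mat A" "A \<in> carrier_mat n n" for A S
  proof -
    have "cnj (det S) * det A * det S = 1"
      using arg_cong[OF S(2), of det] S(1) A(2) by (simp add: det_mult[of _ n] det_adjoint[of _ n])
    then have "of_real ((cmod (det S))\<^sup>2) * det A = 1"
      by (simp add: complex_norm_square mult_ac del: of_real_power)
    moreover have "det A = of_real (Re (det A))"
      using det_psd_nonneg[OF A] by (simp add: less_eq_complex_def complex_eq_iff)
    ultimately show ?thesis by (metis of_real_1 of_real_eq_iff of_real_mult)
  qed
  have "(cmod (det S) * cmod (det B) * cmod (det T))\<^sup>2 \<le> 1"
    using le by (simp add: power_le_one)
  moreover have "0 \<le> Re (det A) * Re (det D)"
    using det_psd_nonneg[OF A] det_psd_nonneg[OF D] by (simp add: less_eq_complex_def)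
  ultimately have "(cmod (det S) * cmod (det B) * cmod (det T))\<^sup>2 * (Re (det A) * Re (det D)) \<le> Re (det A) * Re (det D)"
    by (metis mult_left_le_one_le zero_le_power2 mult.commute)
  moreover have "(cmod (det S) * cmod (det B) * cmod (det T))\<^sup>2 * (Re (det A) * Re (det D)) =
      ((cmod (det S))\<^sup>2 * Re (det A)) * (cmod (det B))\<^sup>2 * ((cmod (det T))\<^sup>2 * Re (det D))"
    by (simp add: power_mult_distrib)
  ultimately show ?thesis using sA[OF S A] sA[OF T D] by simp
qed

text \<open>Adds two Cauchy-Schwarz bounds; the cross term is handled by the arithmetic-geometric
  mean inequality for \<open>p * s\<close> and \<open>r * q\<close>.\<close>

lemma square_sum_le_mult:
  fixes p q r s u v :: real
  assumes "u\<^sup>2 \<le> p * q" "v\<^sup>2 \<le> r * s" "0 \<le> p" "0 \<le> q" "0 \<le> r" "0 \<le> s"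
  shows "(u + v)\<^sup>2 \<le> (p + r) * (q + s)"
proof -
  have "(2 * u * v)\<^sup>2 = 4 * (u\<^sup>2 * v\<^sup>2)" by (simp add: power_mult_distrib)
  also have "\<dots> \<le> 4 * ((p * q) * (r * s))" using assms by (intro mult_left_mono mult_mono) auto
  also have "\<dots> \<le> (p * s + r * q)\<^sup>2"
    using zero_le_power2[of "p * s - r * q"] by (simp add: power2_eq_square algebra_simps)
  finally have "2 * u * v \<le> p * s + r * q"
    using assms by (intro power2_le_imp_le[of "2 * u * v"]) auto
  then show ?thesis using assms(1,2) by (simp add: power2_eq_square algebra_simps)
qed

text \<open>With \<open>z = W y\<close>, the mixed form splits into a \<open>P\<close>-part at
  \<open>y, x\<close> and an \<open>R\<close>-part at \<open>z, x\<close>. Cauchy-Schwarz for each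
  part, added up, is the hypothesis of \<open>det_form_Cauchy_Schwarz\<close>.\<close>

lemma det_add_mult_le:
  assumes P: "psd_mat P" "P \<in> carrier_mat n n" and R: "psd_mat R" "R \<in> carrier_mat n n"
    and W: "W \<in> carrier_mat n n"
  shows "(cmod (det (P + R * W)))\<^sup>2 \<le> Re (det (P + R)) * Re (det (P + mat_adjoint W * R * W))"
proof (rule det_form_Cauchy_Schwarz)
  show "psd_mat (P + R)" using P R by (intro psd_mat_add)
  show "psd_mat (P + mat_adjoint W * R * W)"
    using P R W by (intro psd_mat_add psd_mat_conjugation) auto
  fix x y :: "complex vec" assume xy: "x \<in> carrier_vec n" "y \<in> carrier_vec n"
  define z where "z = W *\<^sub>v y"
  have z: "z \<in> carrier_vec n" using W xy by (simp add: z_def)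
  have h1: "((P + R * W) *\<^sub>v y) \<bullet>c x = (P *\<^sub>v y) \<bullet>c x + (R *\<^sub>v z) \<bullet>c x"
    using P(2) R(2) W xy
    by (simp add: add_mult_distrib_mat_vec[of _ n n] add_scalar_prod_distrib[of _ n] assoc_mult_mat_vec[of _ n n _ n] z_def)
  have h2: "((P + R) *\<^sub>v x) \<bullet>c x = (P *\<^sub>v x) \<bullet>c x + (R *\<^sub>v x) \<bullet>c x"
    using P(2) R(2) xy
    by (simp add: add_mult_distrib_mat_vec[of _ n n] add_scalar_prod_distrib[of _ n])
  have h3: "((P + mat_adjoint W * R * W) *\<^sub>v y) \<bullet>c y = (P *\<^sub>v y) \<bullet>c y + (R *\<^sub>v z) \<bullet>c z"
  proof -
    have WRW: "mat_adjoint W * R * W \<in> carrier_mat n n" using R(2) W by simp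
    have "((P + mat_adjoint W * R * W) *\<^sub>v y) \<bullet>c y =
        (P *\<^sub>v y) \<bullet>c y + ((mat_adjoint W * R * W) *\<^sub>v y) \<bullet>c y"
      unfolding add_mult_distrib_mat_vec[OF P(2) WRW xy(2)]
      using mult_mat_vec_carrier[OF P(2) xy(2)] mult_mat_vec_carrier[OF WRW xy(2)] xy(2)
      by (intro add_scalar_prod_distrib[of _ n]) auto
    then show ?thesis using form_conjugation[OF R(2) W W xy(2) xy(2)] by (simp add: z_def)
  qed
  have h4: "(cmod ((P *\<^sub>v y) \<bullet>c x + (R *\<^sub>v z) \<bullet>c x))\<^sup>2
      \<le> (cmod ((P *\<^sub>v y) \<bullet>c x) + cmod ((R *\<^sub>v z) \<bullet>c x))\<^sup>2"
    by (rule power_mono[OF norm_triangle_ineq norm_ge_zero])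
  have h5: "(cmod ((P *\<^sub>v y) \<bullet>c x) + cmod ((R *\<^sub>v z) \<bullet>c x))\<^sup>2 \<le>
      (Re ((P *\<^sub>v x) \<bullet>c x) + Re ((R *\<^sub>v x) \<bullet>c x)) * (Re ((P *\<^sub>v y) \<bullet>c y) + Re ((R *\<^sub>v z) \<bullet>c z))"
    using psd_form_Cauchy_Schwarz[OF P xy(2,1)] psd_form_Cauchy_Schwarz[OF R z xy(1)]
      psd_mat_form[OF P xy(1)] psd_mat_form[OF P xy(2)] psd_mat_form[OF R xy(1)] psd_mat_form[OF R z]
    by (intro square_sum_le_mult) (auto simp: less_eq_complex_def mult.commute)
  show "(cmod (((P + R * W) *\<^sub>v y) \<bullet>c x))\<^sup>2 \<le>
      Re (((P + R) *\<^sub>v x) \<bullet>c x) * Re (((P + mat_adjoint W * R * W) *\<^sub>v y) \<bullet>c y)"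
    unfolding h1 h2 h3 plus_complex.sel using h4 h5 by (rule order_trans)
qed (use P R W in auto)

text \<open>Each eigenvalue satisfies \<open>d i \<le> exp (d i - 1)\<close>, and the exponents sum
  to zero.\<close>

lemma det_psd_le_1:
  assumes P: "psd_mat P" "P \<in> carrier_mat n n" and tr: "mat_trace P = of_nat n"
  shows "Re (det P) \<le> 1"
proof -
  obtain U d where U: "U \<in> carrier_mat n n" "unitary_mat U" "\<And>i. i < n \<Longrightarrow> 0 \<le> d i"
    "P = U * mat_diag n (\<lambda>i. of_real (d i)) * mat_adjoint U"
    using psd_mat_spectral[OF P] by metis
  have "mat_trace P = mat_trace (mat_adjoint U * (U * mat_diag n (\<lambda>i. of_real (d i))))"
    unfolding U(4) using U(1) by (intro mat_trace_comm[of _ n n]) auto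
  also have "\<dots> = of_real (\<Sum>i<n. d i)"
    using U(1) unitary_matD[OF U(2,1)] by (simp add: mult_cancel_middle[of _ _ n] mat_trace_diag)
  finally have sum: "(\<Sum>i<n. d i) = real n"
    using tr by (metis of_real_eq_iff of_real_of_nat_eq)
  have "det P = of_real (\<Prod>i<n. d i)"
    unfolding U(4) using U(1,2) by (simp add: det_conj_unitary[of _ n] det_mat_diag)
  then have "Re (det P) = (\<Prod>i<n. d i)" by (simp del: of_real_prod)
  also have "\<dots> \<le> (\<Prod>i<n. exp (d i - 1))"
    using U(3) exp_ge_add_one_self[of "d _ - 1"] by (intro prod_mono) auto
  also have "\<dots> = 1" by (simp add: exp_sum[symmetric] sum_subtractf sum)
  finally show ?thesis .
qed

section \<open>The determinant of Q1 + V Q2\<close>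

lemma inverse_of_det_nonzero:
  fixes K :: "complex mat"
  assumes K: "K \<in> carrier_mat n n" "det K \<noteq> 0"
  obtains L where "L \<in> carrier_mat n n" "L * K = 1\<^sub>m n" "K * L = 1\<^sub>m n"
  using det_non_zero_imp_unit[OF K, of "()"] by (auto simp: Units_def ring_mat_def)

text \<open>With C = L Q1 and R = L S one has C + R = 1, and R = R C + R R, where R C is congruent
  to S Q1.\<close>

lemma psd_left_quotient:
  assumes Q: "psd_mat Q1" "Q1 \<in> carrier_mat n n" and S: "S \<in> carrier_mat n n" "psd_mat (S * Q1)"
    and L: "L \<in> carrier_mat n n" "L * (Q1 + S) = 1\<^sub>m n" "(Q1 + S) * L = 1\<^sub>m n"
  shows "psd_mat (L * Q1)" "psd_mat (L * S)"
proof -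
  define K where "K = Q1 + S"
  have K: "K \<in> carrier_mat n n" using Q S by (simp add: K_def)
  note L' = L(2,3)[folded K_def]
  have Q1: "mat_adjoint Q1 = Q1" using psd_mat_hermitian[OF Q(1)] by (rule hermitian_matD)
  have "K * Q1 = mat_adjoint Q1 * Q1 + S * Q1"
    using Q S by (simp add: K_def Q1 add_mult_distrib_mat[of _ n n])
  then have psd: "psd_mat (K * Q1)"
    using psd_mat_add[OF psd_mat_gram[OF Q(2)] S(2), of n] Q S by simp
  have KL: "mat_adjoint K * mat_adjoint L = 1\<^sub>m n"
    using arg_cong[OF L'(1), of mat_adjoint] L(1) K by (simp add: adjoint_mult[of _ n n _ n])
  \<comment> \<open>Self-adjointness of \<open>K * Q1\<close> lets the adjoint of \<open>K\<close>
    meet the adjoint of \<open>L\<close>, so that the congruence of \<open>K * Q1\<close> by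
    \<open>L\<close> collapses to \<open>L * Q1\<close>.\<close>
  have comm: "K * Q1 = Q1 * mat_adjoint K"
    using hermitian_matD(1)[OF psd_mat_hermitian[OF psd]] Q K by (simp add: adjoint_mult[of _ n n _ n] Q1)
  have "L * (K * Q1) * mat_adjoint L = L * Q1"
    unfolding comm using Q(2) K L(1) KL by (simp add: assoc_mult_mat[of _ n n _ n _ n])
  then show C: "psd_mat (L * Q1)"
    using psd_mat_conjugation'[OF psd, of n L] Q K L by simp
  have LQ: "L * Q1 = Q1 * mat_adjoint L"
    using hermitian_matD(1)[OF psd_mat_hermitian[OF C]] Q L by (simp add: adjoint_mult[of _ n n _ n] Q1)
  have sum: "L * Q1 + L * S = 1\<^sub>m n"
    using L(2) Q S L(1) by (simp add: mult_add_distrib_mat[of _ n n])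
  \<comment> \<open>This makes \<open>L * S\<close> Hermitian, so its square is a Gram
    matrix.\<close>
  have "L * S = 1\<^sub>m n - L * Q1"
  proof -
    have "1\<^sub>m n - L * Q1 = L * Q1 + L * S - L * Q1" by (simp add: sum)
    then show ?thesis using L(1) Q S by (intro eq_matI) auto
  qed
  then have adj: "mat_adjoint (L * S) = L * S"
    using hermitian_matD(1)[OF psd_mat_hermitian[OF C]] L(1) Q by (simp add: adjoint_minus[of _ n n])
  have "L * S = (L * S) * (L * Q1 + L * S)" using sum L(1) S by simp
  also have "\<dots> = (L * S) * (L * Q1) + (L * S) * (L * S)"
    using L(1) S Q by (intro mult_add_distrib_mat) auto
  also have "(L * S) * (L * Q1) = L * (S * Q1) * mat_adjoint L"
    unfolding LQ using L(1) S Q by (simp add: assoc_mult_mat[of _ n n _ n _ n])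
  finally have "L * S = L * (S * Q1) * mat_adjoint L + mat_adjoint (L * S) * (L * S)"
    unfolding adj .
  moreover have "psd_mat (L * (S * Q1) * mat_adjoint L + mat_adjoint (L * S) * (L * S))"
    using L(1) S Q by (intro psd_mat_add psd_mat_conjugation' psd_mat_gram) auto
  ultimately show "psd_mat (L * S)" by simp
qed

text \<open>Bounding the modulus covers every phase of the determinant. Let \<open>k\<close> be the
  modulus of \<open>det K\<close> and \<open>m\<close> the real part of
  \<open>det (Q1 + V * Q2 * mat_adjoint V)\<close>; then \<open>k * k\<close> is at most
  \<open>det (Q1 + Q2)\<close> times \<open>m\<close>, and \<open>m \<le> k\<close>, so one factor
  \<open>k\<close> cancels.\<close>

lemma cmod_det_polar_sum_le:
  assumes Q1: "psd_mat Q1" "Q1 \<in> carrier_mat n n" and Q2: "psd_mat Q2" "Q2 \<in> carrier_mat n n"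
    and V: "unitary_mat V" "V \<in> carrier_mat n n" and G: "psd_mat (V * Q2 * Q1)"
  shows "cmod (det (Q1 + V * Q2)) \<le> Re (det (Q1 + Q2))"
proof (cases "det (Q1 + V * Q2) = 0")
  case True
  then show ?thesis
    using det_psd_nonneg[OF psd_mat_add[OF Q1(1) Q2(1) Q1(2) Q2(2)] add_carrier_mat[OF Q2(2)]]
    by (simp add: less_eq_complex_def)
next
  case False
  define S where "S = V * Q2"
  define K where "K = Q1 + S"
  have S: "S \<in> carrier_mat n n" and K: "K \<in> carrier_mat n n" using Q1 Q2 V by (auto simp: S_def K_def)
  obtain L where L: "L \<in> carrier_mat n n" "L * K = 1\<^sub>m n" "K * L = 1\<^sub>m n"
    using inverse_of_det_nonzero[OF K] False by (auto simp: K_def S_def)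
  define C where "C = L * Q1"
  define R where "R = L * S"
  have CR: "C \<in> carrier_mat n n" "R \<in> carrier_mat n n" using L S Q1 by (auto simp: C_def R_def)
  have psd: "psd_mat C" "psd_mat R"
    using psd_left_quotient[OF Q1 S _ L(1)] G L by (auto simp: C_def R_def K_def S_def)
  have sum: "C + R = 1\<^sub>m n"
    using L(2) Q1 S L(1) by (simp add: C_def R_def K_def mult_add_distrib_mat[of _ n n])
  have Va: "mat_adjoint V \<in> carrier_mat n n" using V by simp
  have adjQ: "mat_adjoint Q1 = Q1" "mat_adjoint Q2 = Q2"
    using Q1 Q2 psd_mat_hermitian hermitian_matD(1) by auto
  have KC: "K * C = Q1" and KR: "K * R = S"
    using L K S Q1 by (auto simp: C_def R_def mult_cancel_middle[of _ _ n])

  \<comment> \<open>Unitary conjugation of \<open>R\<close> preserves its trace, so the trace is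
    that of \<open>C + R\<close>, the identity.\<close>
  have "mat_trace (C + V * R * mat_adjoint V) = mat_trace C + mat_trace (mat_adjoint V * (V * R))"
    using CR V mat_trace_comm[of "V * R" n n "mat_adjoint V"] by (simp add: mat_trace_add[of _ n])
  also have "\<dots> = mat_trace (C + R)"
    using CR V unitary_matD[OF V] by (simp add: mat_trace_add[of _ n] mult_cancel_middle[of _ _ n])
  finally have "mat_trace (C + V * R * mat_adjoint V) = of_nat n" by (simp add: sum)
  then have "Re (det (C + V * R * mat_adjoint V)) \<le> 1"
    using CR V psd by (intro det_psd_le_1[of _ n] psd_mat_add psd_mat_conjugation') auto
  then have "(cmod (det (C + R * mat_adjoint V)))\<^sup>2 \<le> 1"
    using det_add_mult_le[OF psd(1) CR(1) psd(2) CR(2) Va] by (simp add: sum)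
  then have le1: "cmod (det (C + R * mat_adjoint V)) \<le> 1" by (simp add: abs_square_le_1)

  have "K * (C + R * mat_adjoint V) = Q1 + V * Q2 * mat_adjoint V"
  proof -
    have "K * (C + R * mat_adjoint V) = K * C + K * R * mat_adjoint V"
      using K CR V by (simp add: mult_add_distrib_mat[of _ n n] assoc_mult_mat[of _ n n _ n _ n])
    then show ?thesis by (simp add: KC KR S_def)
  qed
  then have "Re (det (Q1 + V * Q2 * mat_adjoint V)) \<le> cmod (det K) * cmod (det (C + R * mat_adjoint V))"
    using K CR V complex_Re_le_cmod[of "det (Q1 + V * Q2 * mat_adjoint V)"]
    by (metis Va add_carrier_mat det_mult mult_carrier_square norm_mult)
  also have "\<dots> \<le> cmod (det K)" using le1 by (simp add: mult_left_le)
  finally have le2: "Re (det (Q1 + V * Q2 * mat_adjoint V)) \<le> cmod (det K)" .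

  \<comment> \<open>Passing to the adjoint puts the unitary factor on the right, the shape required
    by \<open>det_add_mult_le\<close>; the modulus of the determinant is unchanged.\<close>
  have "mat_adjoint K = Q1 + Q2 * mat_adjoint V"
    using Q1 Q2 V S by (simp add: K_def S_def adjoint_add[of _ n n] adjoint_mult[of _ n n _ n] adjQ)
  then have "(cmod (det K))\<^sup>2 \<le> Re (det (Q1 + Q2)) * Re (det (Q1 + V * Q2 * mat_adjoint V))"
    using det_add_mult_le[OF Q1 Q2 Va] det_adjoint[OF K] by simp
  also have "\<dots> \<le> Re (det (Q1 + Q2)) * cmod (det K)"
    using det_psd_nonneg[OF psd_mat_add[OF Q1(1) Q2(1) Q1(2) Q2(2)] add_carrier_mat[OF Q2(2)]] le2
    by (intro mult_left_mono) (auto simp: less_eq_complex_def)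
  finally have "cmod (det K) \<le> Re (det (Q1 + Q2))"
    using False by (simp add: power2_eq_square K_def S_def)
  then show ?thesis by (simp add: K_def S_def)
qed

text \<open>If \<open>L\<close> inverts \<open>Q1 + S\<close>, then
  \<open>det (L * Q1) * det (Q1 + S) = det Q1\<close>, where the first factor is nonnegative and the
  product is positive.\<close>

lemma det_polar_sum_nonneg:
  assumes Q1: "psd_mat Q1" "Q1 \<in> carrier_mat n n" "det Q1 \<noteq> 0"
    and S: "S \<in> carrier_mat n n" "psd_mat (S * Q1)"
  shows "0 \<le> det (Q1 + S)"
proof (cases "det (Q1 + S) = 0")
  case False
  have K: "Q1 + S \<in> carrier_mat n n" using Q1 S by simp
  obtain L where L: "L \<in> carrier_mat n n" "L * (Q1 + S) = 1\<^sub>m n" "(Q1 + S) * L = 1\<^sub>m n"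
    using inverse_of_det_nonzero[OF K False] .
  have "0 \<le> det (L * Q1)"
    using psd_left_quotient(1)[OF Q1(1,2) S L] L(1) Q1(2) by (intro det_psd_nonneg[of _ n]) auto
  moreover have "det (L * Q1) * det (Q1 + S) = det Q1"
    using arg_cong[OF L(2), of det] L(1) Q1(2) K by (simp add: det_mult[of _ n] mult_ac)
  moreover have "0 \<le> det Q1" using det_psd_nonneg[OF Q1(1,2)] .
  ultimately show ?thesis
    using Q1(3) mult_nonneg_nonpos[of "Re (det (L * Q1))" "Re (det (Q1 + S))"]
    by (force simp: less_eq_complex_def complex_eq_iff)
qed simp

text \<open>Singularity provides an eigenvector of \<open>Q\<close> with eigenvalue zero;
  \<open>J\<close> multiplies it by \<open>c\<close> and fixes the other vectors of the
  eigenbasis.\<close>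

lemma exists_unitary_fixing_range:
  assumes Q: "psd_mat Q" "Q \<in> carrier_mat n n" "det Q = 0" and c: "cmod c = 1"
  obtains J where "J \<in> carrier_mat n n" "unitary_mat J" "J * Q = Q" "det J = c"
proof -
  obtain U d where U: "U \<in> carrier_mat n n" "unitary_mat U" "\<And>i. i < n \<Longrightarrow> 0 \<le> d i"
    "Q = U * mat_diag n (\<lambda>i. of_real (d i)) * mat_adjoint U"
    using psd_mat_spectral[OF Q(1,2)] by metis
  have "det Q = (\<Prod>i<n. of_real (d i))"
    unfolding U(4) using U(1,2) by (simp add: det_conj_unitary[of _ n] det_mat_diag)
  then obtain i where i: "i < n" "d i = 0" using Q(3) by auto
  define E where "E = mat_diag n (\<lambda>j. if j = i then c else 1)"
  have E: "E \<in> carrier_mat n n" by (simp add: E_def)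
  have "c * cnj c = 1" using c by (metis complex_norm_square of_real_1 one_power2)
  then have "mat_adjoint E * E = 1\<^sub>m n"
    unfolding E_def adjoint_mat_diag mat_diag_diag
    by (intro eq_matI) (auto simp: mat_diag_def mult.commute)
  then have uE: "unitary_mat E" using E by (intro unitary_matI)
  have ED: "E * mat_diag n (\<lambda>i. of_real (d i)) = mat_diag n (\<lambda>i. of_real (d i))"
    unfolding E_def mat_diag_diag using i by (intro eq_matI) (auto simp: mat_diag_def)
  define J where "J = U * E * mat_adjoint U"
  have "J * Q = U * (E * mat_diag n (\<lambda>i. of_real (d i))) * mat_adjoint U"
    unfolding J_def U(4) using U(1) E unitary_matD[OF U(2,1)]
    by (simp add: assoc_mult_mat[of _ n n _ n _ n] mult_cancel_middle[of _ _ n] del: mat_diag_diag)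
  then have "J * Q = Q" by (simp only: ED U(4)[symmetric])
  moreover have "det J = c"
    unfolding J_def using U(1,2) E i by (simp add: det_conj_unitary[of _ n] E_def det_mat_diag)
  moreover have "unitary_mat J"
    unfolding J_def using U(1,2) E uE unitary_mat_adjoint[OF U(2,1)]
    by (intro unitary_mat_mult[of _ n]) auto
  moreover have "J \<in> carrier_mat n n" using U(1) E by (simp add: J_def)
  ultimately show ?thesis using that by blast
qed

text \<open>By \<open>polar_factor_det_not_real\<close>, a unitary factor of \<open>Q2 * Q1\<close>
  can give a non-real determinant when \<open>Q1\<close> is singular. Hence nonnegativity for all
  factors is stated for invertible \<open>Q1\<close>, the upper bound for real determinants, and in
  general some factor has all the properties.\<close>

theorem theorem1:
  fixes Q1 Q2 :: "complex mat" and n :: nat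
  assumes "Q1 \<in> carrier_mat n n" and "Q2 \<in> carrier_mat n n"
    and "psd_mat Q1" and "psd_mat Q2"
  shows "(\<forall>U \<in> carrier_mat n n. polar_decomposition (Q2 * Q1) U \<longrightarrow>
            (invertible_mat Q1 \<longrightarrow>
               det (Q1 + mat_adjoint U * Q2) \<in> \<real> \<and> 0 \<le> det (Q1 + mat_adjoint U * Q2)) \<and>
            (det (Q1 + mat_adjoint U * Q2) \<in> \<real> \<longrightarrow>
               det (Q1 + mat_adjoint U * Q2) \<le> det (Q1 + Q2))) \<and>
         (\<exists>U \<in> carrier_mat n n. polar_decomposition (Q2 * Q1) U \<and>
            det (Q1 + mat_adjoint U * Q2) \<in> \<real> \<and> 0 \<le> det (Q1 + mat_adjoint U * Q2) \<and>
            det (Q1 + mat_adjoint U * Q2) \<le> det (Q1 + Q2))"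
proof -
  note Q = assms
  have X: "Q2 * Q1 \<in> carrier_mat n n" using Q by simp
  define M where "M = mat_modulus (Q2 * Q1)"
  have M: "M \<in> carrier_mat n n" "psd_mat M" using psd_mat_modulus[OF X] by (auto simp: M_def)
  \<comment> \<open>Every polar factor yields the same positive semidefinite product, which is the
    hypothesis on \<open>V\<close> in the determinant estimates.\<close>
  have UX: "mat_adjoint U * Q2 * Q1 = M"
    if "U \<in> carrier_mat n n" "polar_decomposition (Q2 * Q1) U" for U
  proof -
    have U: "unitary_mat U" "Q2 * Q1 = U * M" using that by (auto simp: polar_decomposition_def M_def)
    have "mat_adjoint U * Q2 * Q1 = mat_adjoint U * (U * M)"
      using Q that(1) by (simp add: U(2)[symmetric] assoc_mult_mat[of _ n n _ n _ n])
    then show ?thesis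
      using M that(1) unitary_matD[OF U(1) that(1)] by (simp add: mult_cancel_middle[of _ _ n])
  qed
  have sum_psd: "0 \<le> det (Q1 + Q2)"
    using det_psd_nonneg[OF psd_mat_add[OF Q(3,4,1,2)] add_carrier_mat[OF Q(2)]] .
  have upper: "det (Q1 + mat_adjoint U * Q2) \<le> det (Q1 + Q2)"
    if U: "U \<in> carrier_mat n n" "polar_decomposition (Q2 * Q1) U"
      and real: "det (Q1 + mat_adjoint U * Q2) \<in> \<real>" for U
  proof -
    have "cmod (det (Q1 + mat_adjoint U * Q2)) \<le> Re (det (Q1 + Q2))"
      using cmod_det_polar_sum_le[OF Q(3,1,4,2), of "mat_adjoint U"] UX[OF U] M U
        unitary_mat_adjoint[of U n] by (auto simp: polar_decomposition_def)
    then show ?thesis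
      using complex_Re_le_cmod[of "det (Q1 + mat_adjoint U * Q2)"] real sum_psd
      by (auto simp: less_eq_complex_def complex_is_Real_iff)
  qed
  have lower: "0 \<le> det (Q1 + mat_adjoint U * Q2)"
    if U: "U \<in> carrier_mat n n" "polar_decomposition (Q2 * Q1) U" and "det Q1 \<noteq> 0" for U
    using det_polar_sum_nonneg[OF Q(3,1) that(3), of "mat_adjoint U * Q2"] UX[OF U] M Q U by simp
  have realI: "z \<in> \<real>" if "0 \<le> z" for z :: complex
    using that by (simp add: less_eq_complex_def complex_is_Real_iff)
  have "\<exists>U \<in> carrier_mat n n. polar_decomposition (Q2 * Q1) U \<and> 0 \<le> det (Q1 + mat_adjoint U * Q2)"
  proof -
    obtain U where U: "U \<in> carrier_mat n n" "polar_decomposition (Q2 * Q1) U"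
      using polar_decomposition_exists[OF X] .
    have uU: "unitary_mat U" using U by (simp add: polar_decomposition_def)
    define S where "S = mat_adjoint U * Q2"
    have S: "S \<in> carrier_mat n n" using U Q by (simp add: S_def)
    define k where "k = det (Q1 + S)"
    show ?thesis
    proof (cases "k = 0 \<or> det Q1 \<noteq> 0")
      case True
      then show ?thesis using U lower[OF U] by (auto simp: k_def S_def)
    next
      case False
      \<comment> \<open>The phase that turns \<open>k\<close> into its modulus.\<close>
      define c where "c = cnj k / of_real (cmod k)"
      have "cmod c = 1" using False by (simp add: c_def norm_divide)
      then obtain J where J: "J \<in> carrier_mat n n" "unitary_mat J" "J * Q1 = Q1" "det J = c"
        using exists_unitary_fixing_range[OF Q(3,1)] False by blast
      have adj: "mat_adjoint Q1 = Q1" "mat_adjoint Q2 = Q2" "mat_adjoint M = M"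
        using Q M psd_mat_hermitian hermitian_matD(1) by auto
      \<comment> \<open>The range of \<open>M\<close> lies in that of \<open>Q1\<close>, so
        \<open>J\<close> fixes \<open>M\<close>; its adjoint then fixes \<open>M\<close> too, and
        \<open>U * mat_adjoint J\<close> is again a polar factor.\<close>
      have "M = Q1 * (Q2 * U)"
        using arg_cong[OF UX[OF U], of mat_adjoint] U Q
        by (simp add: adj adjoint_mult[of _ n n _ n])
      then have "J * M = J * Q1 * (Q2 * U)"
        using J(1) Q U by (simp add: assoc_mult_mat[of _ n n _ n _ n])
      then have JM: "J * M = M" by (simp add: J(3) \<open>M = Q1 * (Q2 * U)\<close>)
      have "mat_adjoint J * M = mat_adjoint J * (J * M)" by (simp add: JM)
      then have JM': "mat_adjoint J * M = M"
        using J M unitary_matD[OF J(2,1)] by (simp add: mult_cancel_middle[of _ _ n])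
      define U' where "U' = U * mat_adjoint J"
      have U': "U' \<in> carrier_mat n n" "unitary_mat U'"
        using U J uU unitary_mat_mult[of U n "mat_adjoint J"] unitary_mat_adjoint[of J n]
        by (auto simp: U'_def)
      have "U' * M = U * M"
        using U J M by (simp add: U'_def assoc_mult_mat[of _ n n _ n _ n] JM')
      then have pol: "polar_decomposition (Q2 * Q1) U'"
        using U(2) U' by (simp add: polar_decomposition_def M_def)
      \<comment> \<open>As \<open>J * Q1 = Q1\<close>, the change of factor multiplies the whole sum
        by \<open>J\<close>, and its determinant by \<open>c\<close>.\<close>
      have "Q1 + mat_adjoint U' * Q2 = J * (Q1 + S)"
        using U(1) J Q S by (simp add: U'_def S_def adjoint_mult[of _ n n _ n]
            mult_add_distrib_mat[of _ n n] assoc_mult_mat[of _ n n _ n _ n])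
      then have "det (Q1 + mat_adjoint U' * Q2) = c * k"
        using J Q S by (simp add: k_def det_mult[of _ n])
      also have "\<dots> = of_real (cmod k)"
        using False by (simp add: c_def complex_norm_square[symmetric] power2_eq_square mult.commute)
      finally show ?thesis using U' pol by (intro bexI[of _ U']) (auto simp: less_eq_complex_def)
    qed
  qed
  moreover have "det Q1 \<noteq> 0" if inv: "invertible_mat Q1"
  proof -
    obtain B where B: "Q1 * B = 1\<^sub>m n" "B * Q1 = 1\<^sub>m (dim_row B)"
      using inv Q(1) by (auto simp: invertible_mat_def inverts_mat_def)
    have "B \<in> carrier_mat n n"
      using arg_cong[OF B(1), of dim_col] arg_cong[OF B(2), of dim_col] Q(1) by auto
    then show ?thesis using arg_cong[OF B(1), of det] Q(1) by (auto simp: det_mult[of _ n])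
  qed
  ultimately show ?thesis using upper lower realI by blast
qed

end
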